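(* Let $f,g:\mathbb R^n\to\mathbb R$ be two even functionals of class $C^1$ and let $a>0$ be fixed. Assume that $g$ satisfies: 1) $\{x\in\mathbb R^n:\ g(x)=0\}=\{0\}$; 2) $\langle g'(x),x\rangle>0$ for every $x\in\mathbb R^n\setminus\{0\}$; 3) $\lim_{\|x\|\to\infty}g(x)=\infty$. Then $f$ admits at least $2n$ critical points with respect to $g$ and $a$.
   Context: A point $x\in\mathbb R^n$ is a critical point of $f$ with respect to $g$ and $a$ if $g(x)=a$ and there exists $\lambda\in\mathbb R$ such that $f'(x)=\lambda g'(x)$. *)

theory Defs
  imports "HOL-Analysis.Analysis"
begin

text \<open>Class \<open>C\<^sup>1\<close> on the whole space: the derivative is continuous as a map into the dual space,
  i.e. for the operator norm.\<close>

definition class_C1 :: "('a::real_normed_vector \<Rightarrow> real) \<Rightarrow> bool" where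
  "class_C1 f \<longleftrightarrow>
     (\<exists>f' :: 'a \<Rightarrow> 'a \<Rightarrow>\<^sub>L real.
        (\<forall>x. (f has_derivative blinfun_apply (f' x)) (at x)) \<and> continuous_on UNIV f')"

definition critical_point ::
  "('a::real_normed_vector \<Rightarrow> real) \<Rightarrow> ('a \<Rightarrow> real) \<Rightarrow> real \<Rightarrow> 'a \<Rightarrow> bool" where
  "critical_point f g a x \<longleftrightarrow>
     g x = a \<and>
     (\<exists>l::real. frechet_derivative f (at x) = (\<lambda>v. l * frechet_derivative g (at x) v))"

end

theory Submission
  imports Defs "HOL-Homology.Invariance_of_Domain"
begin

text \<open>
  Every ray from the origin meets \<open>{g = a}\<close> in exactly one point \<open>\<rho> x *\<^sub>R x\<close>, and \<open>\<rho>\<close> is of class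
  \<open>C\<^sup>1\<close>. Hence \<open>F x = f (\<rho> x *\<^sub>R x)\<close> is an even, positively homogeneous function of degree 0, and its
  critical points on the unit sphere give critical points of \<open>f\<close> with respect to \<open>g\<close> and \<open>a\<close>. Suppose that
  there are finitely many, and choose a linear functional that vanishes at none of them. When the level
  crosses a critical value, one gradient step maps the part of the sublevel set of \<open>F\<close> on which this
  functional vanishes into a lower sublevel set; so the least number of odd functions without common
  zero on the sublevel set grows by at most one there, and it does not grow elsewhere.
  On the whole sphere this number is at least \<open>n\<close> by Borsuk--Ulam, so \<open>F\<close> has at least \<open>n\<close> critical
  values, each attained at an antipodal pair.
\<close>

section \<open>The Borsuk--Ulam theorem\<close>

text \<open>The carrier of the library's \<open>nsphere k\<close>; with it, maps of spheres can be
  handled through \<open>continuous_on\<close> in the function space.\<close>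

definition std_sphere :: "nat \<Rightarrow> (nat \<Rightarrow> real) set" where
  "std_sphere k = {x. (\<Sum>i\<le>k. (x i)\<^sup>2) = 1 \<and> (\<forall>i>k. x i = 0)}"

lemma nsphere_eq_top_of_set: "nsphere k = top_of_set (std_sphere k)"
  by (simp add: nsphere std_sphere_def euclidean_product_topology)

lemma topspace_nsphere_eq: "topspace (nsphere k) = std_sphere k"
  by (simp add: nsphere_eq_top_of_set)

lemma continuous_map_nsphere_iff:
  "continuous_map (nsphere k) (nsphere l) f \<longleftrightarrow> continuous_on (std_sphere k) f \<and> f \<in> std_sphere k \<rightarrow> std_sphere l"
  by (simp add: nsphere_eq_top_of_set continuous_map_in_subtopology image_subset_iff_funcset)

lemma continuous_on_coordinate [continuous_intros]:
  "continuous_on S (\<lambda>x::'b \<Rightarrow> real. x i)"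
  by (rule continuous_on_subset [OF continuous_on_product_coordinates]) auto

definition normalized :: "nat \<Rightarrow> (nat \<Rightarrow> real) \<Rightarrow> nat \<Rightarrow> real" where
  "normalized k v = (\<lambda>i. v i / sqrt (\<Sum>j\<le>k. (v j)\<^sup>2))"

lemma sum_squares_pos:
  fixes v :: "nat \<Rightarrow> real"
  assumes "\<exists>i\<le>k. v i \<noteq> 0"
  shows "(\<Sum>j\<le>k. (v j)\<^sup>2) > 0"
  using assms by (auto intro!: sum_pos2)

lemma normalized_in_std_sphere:
  assumes "\<exists>i\<le>k. v i \<noteq> 0" "\<And>i. i > k \<Longrightarrow> v i = 0"
  shows "normalized k v \<in> std_sphere k"
  using sum_squares_pos [OF assms(1)] assms(2)
  by (auto simp: std_sphere_def normalized_def power_divide real_sqrt_pow2 sum_nonneg simp flip: sum_divide_distrib)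

lemma normalized_std_sphere: "v \<in> std_sphere k \<Longrightarrow> normalized k v = v"
  by (simp add: normalized_def std_sphere_def)

lemma continuous_on_normalized:
  assumes "\<And>i. continuous_on S (\<lambda>x. v x i)" and "\<And>x. x \<in> S \<Longrightarrow> \<exists>i\<le>k. v x i \<noteq> 0"
  shows "continuous_on S (\<lambda>x. normalized k (v x))"
proof (rule continuous_on_coordinatewise_then_product)
  fix i
  have "sqrt (\<Sum>j\<le>k. (v x j)\<^sup>2) \<noteq> 0" if "x \<in> S" for x
    using sum_squares_pos [OF assms(2) [OF that]] by simp
  then show "continuous_on S (\<lambda>x. normalized k (v x) i)"
    unfolding normalized_def using assms(1) by (intro continuous_intros) auto
qed

text \<open>Dividing a nowhere vanishing deformation by its length keeps it continuous, so
  deformations may leave the sphere; at time 0 nothing changes, because \<open>f\<close> already has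
  unit length.\<close>

lemma homotopic_with_normalized:
  assumes f: "f \<in> std_sphere k \<rightarrow> std_sphere k"
    and cont: "\<And>i. continuous_on ({0..1::real} \<times> std_sphere k) (\<lambda>p. H (fst p) (snd p) i)"
    and zero: "\<And>t x i. t \<in> {0..1} \<Longrightarrow> x \<in> std_sphere k \<Longrightarrow> i > k \<Longrightarrow> H t x i = 0"
    and nz: "\<And>t x. t \<in> {0..1} \<Longrightarrow> x \<in> std_sphere k \<Longrightarrow> \<exists>i\<le>k. H t x i \<noteq> 0"
    and H0: "\<And>x. x \<in> std_sphere k \<Longrightarrow> H 0 x = f x"
  shows "homotopic_with (\<lambda>x. True) (nsphere k) (nsphere k) f (\<lambda>x. normalized k (H 1 x))"
proof -
  let ?N = "\<lambda>p. normalized k (H (fst p) (snd p))"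
  have "continuous_on ({0..1} \<times> std_sphere k) ?N"
    using nz by (intro continuous_on_normalized cont) auto
  moreover have "?N \<in> {0..1} \<times> std_sphere k \<rightarrow> std_sphere k"
    using nz zero by (auto intro!: normalized_in_std_sphere)
  ultimately have "continuous_map (prod_topology (top_of_set {0..1}) (nsphere k)) (nsphere k) ?N"
    by (simp add: nsphere_eq_top_of_set continuous_map_in_subtopology image_subset_iff_funcset)
  then have "homotopic_with (\<lambda>x. True) (nsphere k) (nsphere k) (\<lambda>x. normalized k (H 0 x)) (\<lambda>x. normalized k (H 1 x))"
    unfolding homotopic_with_def by (rule_tac x="?N" in exI) auto
  then show ?thesis
  proof (rule homotopic_with_eq)
    fix x assume "x \<in> topspace (nsphere k)"
    then show "f x = normalized k (H 0 x)"
      using f by (simp add: topspace_nsphere_eq H0 normalized_std_sphere Pi_iff)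
  qed auto
qed

section \<open>General position for odd maps\<close>

text \<open>Stretching a point of the cylinder leaves the convex set
  \<open>norm (q x) \<le> 1\<close>, so the cylinder lies in the frontier of that set, and frontiers
  of convex sets are negligible.\<close>

lemma negligible_cylinder:
  fixes q :: "'a::euclidean_space \<Rightarrow> 'a"
  assumes "linear q"
  shows "negligible {x. norm (q x) = 1}"
proof -
  let ?C = "{x. norm (q x) \<le> 1}"
  have "?C = q -` cball 0 1"
    by auto
  then have "convex ?C" "closed ?C"
    using assms by (auto intro!: convex_linear_vimage continuous_closed_vimage linear_continuous_at
        simp: linear_conv_bounded_linear)
  have "{x. norm (q x) = 1} \<subseteq> frontier ?C"
  proof clarify
    fix x assume x: "norm (q x) = 1"
    have "x \<notin> interior ?C"
    proof
      assume "x \<in> interior ?C"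
      then obtain r where r: "r > 0" "ball x r \<subseteq> ?C"
        by (auto simp: mem_interior)
      define s where "s = r / (2 * (norm x + 1))"
      have s: "s > 0"
        using r by (simp add: s_def add_nonneg_pos)
      have "s * norm x < r"
      proof -
        have "r * norm x < r * (2 * (norm x + 1))"
          using r by (intro mult_strict_left_mono) (auto intro: add_nonneg_pos)
        then show ?thesis
          by (simp add: s_def divide_less_eq add_nonneg_pos)
      qed
      then have "x + s *\<^sub>R x \<in> ball x r"
        using s by (simp add: dist_norm)
      then have "norm (q (x + s *\<^sub>R x)) \<le> 1"
        using r by blast
      moreover have "q (x + s *\<^sub>R x) = (1 + s) *\<^sub>R q x"
        using assms by (simp add: linear_add linear_scale algebra_simps)
      ultimately show False
        using x s by simp
    qed
    then show "x \<in> frontier ?C"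
      using \<open>closed ?C\<close> x by (simp add: frontier_def)
  qed
  with negligible_convex_frontier [OF \<open>convex ?C\<close>] show ?thesis
    by (rule negligible_subset)
qed

text \<open>The odd part of a polynomial approximant is again polynomial, and since \<open>f\<close>
  is odd its error is at most the average of the errors at \<open>x\<close> and
  \<open>- x\<close>.\<close>

lemma odd_polynomial_approximation:
  fixes f :: "'a::euclidean_space \<Rightarrow> 'a"
  assumes "compact S" and "continuous_on S f" and "\<epsilon> > 0"
    and sym: "\<And>x. x \<in> S \<Longrightarrow> - x \<in> S" and odd: "\<And>x. x \<in> S \<Longrightarrow> f (- x) = - f x"
  obtains P where "polynomial_function P" "\<And>x. P (- x) = - P x"
    "\<And>x. x \<in> S \<Longrightarrow> norm (f x - P x) < \<epsilon>"
proof -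
  obtain p where p: "polynomial_function p" and pf: "\<And>x. x \<in> S \<Longrightarrow> norm (f x - p x) < \<epsilon>"
    using Stone_Weierstrass_polynomial_function assms by metis
  define P where "P = (\<lambda>x. (1/2) *\<^sub>R (p x - p (- x)))"
  show thesis
  proof
    have "polynomial_function (p \<circ> (\<lambda>x. - x))"
      by (intro polynomial_function_compose p polynomial_function_minus polynomial_function_id[unfolded id_def])
    then show "polynomial_function P"
      unfolding P_def using p
      by (intro polynomial_function_cmul polynomial_function_diff) (auto simp: o_def)
    show "P (- x) = - P x" for x
      by (simp add: P_def algebra_simps)
    fix x assume x: "x \<in> S"
    have "f x - P x = (1/2) *\<^sub>R ((f x - p x) - (f (- x) - p (- x)))"
      using odd [OF x] by (simp add: P_def algebra_simps flip: scaleR_add_left)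
    also have "norm \<dots> \<le> (1/2) * (norm (f x - p x) + norm (f (- x) - p (- x)))"
      using norm_triangle_ineq4 [of "f x - p x" "f (- x) - p (- x)"] by simp
    also have "\<dots> < \<epsilon>"
      using pf [OF x] pf [OF sym [OF x]] by simp
    finally show "norm (f x - P x) < \<epsilon>" .
  qed
qed

text \<open>Up to a small odd perturbation, the image of the equator \<open>x \<bullet> b = 0\<close> avoids the axis of \<open>b\<close>:
  subtracting \<open>(P x \<bullet> b) *\<^sub>R c\<close> from a polynomial approximation \<open>P\<close> works for almost every \<open>c\<close>, since
  the bad \<open>c\<close> project into the smooth image of a sphere of smaller dimension. The map \<open>\<Phi>\<close> in the proof
  carries the unused coordinates along, so that a cylinder replaces that sphere and source and target
  are the whole space.\<close>

lemma odd_general_position: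
  fixes f :: "'a::euclidean_space \<Rightarrow> 'a"
  assumes B: "B \<subseteq> Basis" and b: "b \<in> Basis" "b \<notin> B" and \<epsilon>: "\<epsilon> > 0"
    and S: "S = {x \<in> sphere 0 1. \<forall>i\<in>Basis - insert b B. x \<bullet> i = 0}"
    and f: "continuous_on S f" "f \<in> S \<rightarrow> S" "\<And>x. x \<in> S \<Longrightarrow> f (- x) = - f x"
  obtains F where "continuous_on S F" "\<And>x. F (- x) = - F x"
    "\<And>x. x \<in> S \<Longrightarrow> norm (f x - F x) < \<epsilon>"
    "\<And>x. x \<in> S \<Longrightarrow> x \<bullet> b = 0 \<Longrightarrow> \<exists>i\<in>B. F x \<bullet> i \<noteq> 0"
proof -
  \<comment> \<open>The bound \<open>1 / 2\<close> gives \<open>norm (P x) \<le> 3 / 2\<close>,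
    hence a total error below \<open>\<eta> + 3 / 2 * \<eta>\<close>, which the bound
    \<open>\<epsilon> / 4\<close> keeps below \<open>\<epsilon>\<close>.\<close>
  define \<eta> where "\<eta> = min (\<epsilon> / 4) (1 / 2)"
  have \<eta>: "\<eta> > 0" "\<eta> \<le> 1 / 2" "\<eta> \<le> \<epsilon> / 4"
    using \<epsilon> by (auto simp: \<eta>_def)
  have "S = sphere 0 1 \<inter> (\<Inter>i\<in>Basis - insert b B. {x. i \<bullet> x = 0})"
    by (auto simp: S inner_commute)
  then have "compact S"
    by (auto intro!: compact_Int_closed closed_INT simp: closed_hyperplane)
  moreover have symS: "- x \<in> S" if "x \<in> S" for x
    using that by (auto simp: S)
  ultimately obtain P where P: "polynomial_function P" "\<And>x. P (- x) = - P x"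
    and fP: "\<And>x. x \<in> S \<Longrightarrow> norm (f x - P x) < \<eta>"
    using odd_polynomial_approximation f \<eta>(1) by metis
  define q where "q = (\<lambda>x::'a. \<Sum>i\<in>B. (x \<bullet> i) *\<^sub>R i)"
  have finB: "finite B"
    using B finite_Basis finite_subset by blast
  have lin: "linear q"
    by (auto simp: q_def linear_iff inner_add_left scaleR_add_left sum.distrib scaleR_sum_right)
  have q_inner: "q x \<bullet> i = (if i \<in> B then x \<bullet> i else 0)" if "i \<in> Basis" for x i
  proof -
    have "q x \<bullet> i = (\<Sum>j\<in>B. if j = i then x \<bullet> j else 0)"
      unfolding q_def inner_sum_left using B that by (intro sum.cong) (auto simp: inner_Basis)
    then show ?thesis
      using finB by simp
  qed
  define Z where "Z = {x. norm (q x) = 1 \<and> P (q x) \<bullet> b \<noteq> 0}"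
  \<comment> \<open>For equatorial \<open>x\<close> with \<open>P x \<bullet> b \<noteq> 0\<close>,
    subtracting \<open>(P x \<bullet> b) *\<^sub>R c\<close> from \<open>P x\<close> cancels all
    components in \<open>B\<close> exactly when \<open>q c\<close> is \<open>q (P x)\<close> divided
    by \<open>P x \<bullet> b\<close>. The first summand collects these bad projections, the second
    leaves the remaining coordinates free.\<close>
  define \<Phi> where "\<Phi> = (\<lambda>x. (1 / (P (q x) \<bullet> b)) *\<^sub>R q (P (q x)) + (x - q x))"
  have "negligible Z"
    using negligible_cylinder [OF lin] by (rule negligible_subset) (auto simp: Z_def)
  moreover have "\<Phi> differentiable_on Z"
  proof -
    have dq: "q differentiable (at x within A)" for x A
      using lin by (simp add: linear_imp_differentiable)
    have dP: "P differentiable (at x within A)" for x A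
      using P(1) by (rule differentiable_at_polynomial_function)
    have dPq: "(\<lambda>x. P (q x)) differentiable (at x within A)" for x A
      using differentiable_chain_within [OF dq dP] by (simp add: o_def)
    have dqPq: "(\<lambda>x. q (P (q x))) differentiable (at x within A)" for x A
      using differentiable_chain_within [OF dPq dq] by (simp add: o_def)
    show ?thesis
      unfolding \<Phi>_def differentiable_on_def
      by (intro ballI differentiable_add differentiable_diff differentiable_scaleR differentiable_divide
          differentiable_inner dq dPq dqPq) (auto simp: Z_def)
  qed
  ultimately have "negligible (\<Phi> ` Z)"
    using negligible_differentiable_image_negligible by (metis order_refl)
  moreover have "\<not> negligible (ball (0::'a) \<eta>)"
    using \<eta>(1) by (simp add: open_not_negligible)
  ultimately obtain c where c: "norm c < \<eta>" "c \<notin> \<Phi> ` Z"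
    by (metis mem_ball_0 negligible_subset subsetI)
  define F where "F = (\<lambda>x. P x - (P x \<bullet> b) *\<^sub>R c)"
  show thesis
  proof
    have "continuous_on S P"
      using P(1) by (simp add: continuous_on_polymonial_function)
    then show "continuous_on S F"
      unfolding F_def by (intro continuous_intros)
    show "F (- x) = - F x" for x
      by (simp add: F_def P(2))
    fix x assume x: "x \<in> S"
    then have fx: "norm (f x) = 1"
      using f(2) by (auto simp: S)
    have "norm (P x) \<le> norm (f x) + norm (f x - P x)"
      by (metis norm_minus_commute norm_triangle_sub)
    then have "norm (P x) \<le> 3 / 2"
      using fP [OF x] \<eta> fx by linarith
    then have "\<bar>P x \<bullet> b\<bar> \<le> 3 / 2"
      using Basis_le_norm [OF b(1)] order_trans by blast
    then have "norm ((P x \<bullet> b) *\<^sub>R c) \<le> 3 / 2 * \<eta>"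
      using mult_mono [of "\<bar>P x \<bullet> b\<bar>" "3 / 2" "norm c" \<eta>] c(1) by simp
    moreover have "norm (f x - F x) \<le> norm (f x - P x) + norm ((P x \<bullet> b) *\<^sub>R c)"
      using norm_triangle_ineq [of "f x - P x" "(P x \<bullet> b) *\<^sub>R c"] by (simp add: F_def algebra_simps)
    ultimately show "norm (f x - F x) < \<epsilon>"
      using fP [OF x] \<eta> \<epsilon> by linarith
    assume xb: "x \<bullet> b = 0"
    show "\<exists>i\<in>B. F x \<bullet> i \<noteq> 0"
    proof (rule ccontr)
      assume "\<not> ?thesis"
      then have 0: "P x \<bullet> i = (P x \<bullet> b) * (c \<bullet> i)" if "i \<in> B" for i
        using that by (auto simp: F_def inner_diff_left)
      show False
      proof (cases "P x \<bullet> b = 0")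
        \<comment> \<open>In every coordinate \<open>f x\<close> or \<open>P x\<close> vanishes, so
          the two are orthogonal; as \<open>f x\<close> has unit length, \<open>P x\<close> cannot
          be within \<open>1 / 2\<close> of it.\<close>
        case True
        have *: "(f x \<bullet> i) * (P x \<bullet> i) = 0" if "i \<in> Basis" for i
          using f(2) x that 0 True by (cases "i \<in> insert b B") (auto simp: S Pi_iff)
        have "f x \<bullet> P x = 0"
          by (subst euclidean_inner) (simp add: *)
        then have "f x \<bullet> (f x - P x) = 1"
          using fx by (simp add: inner_diff_right dot_square_norm)
        then show False
          using norm_cauchy_schwarz [of "f x" "f x - P x"] fx fP [OF x] \<eta> by simp
      next
        case False
        \<comment> \<open>Adding the part of \<open>c\<close> outside \<open>B\<close> gives a
          preimage of \<open>c\<close>: \<open>q\<close> recovers \<open>x\<close>, and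
          \<open>y - q y\<close> supplies exactly that part.\<close>
        define y where "y = x + (c - q c)"
        have qy: "q y = x"
          by (rule euclidean_eqI) (use xb x in \<open>auto simp: y_def q_inner inner_simps S\<close>)
        have "(1 / (P x \<bullet> b)) *\<^sub>R q (P x) = q c"
          by (rule euclidean_eqI) (use 0 False in \<open>auto simp: q_inner\<close>)
        then have "\<Phi> y = c"
          using qy by (simp add: \<Phi>_def) (simp add: y_def)
        moreover have "y \<in> Z"
          using False x qy by (auto simp: Z_def S)
        ultimately show False
          using c(2) by blast
      qed
    qed
  qed
qed

section \<open>Odd self-maps of spheres have odd degree\<close>

lemma inner_enumerated_Basis:
  fixes e :: "nat \<Rightarrow> 'a::euclidean_space"
  assumes "bij_betw e {..<DIM('a)} Basis" and "i < DIM('a)" "j < DIM('a)"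
  shows "e i \<bullet> e j = (if i = j then 1 else 0)"
proof -
  have "e i \<in> Basis" "e j \<in> Basis" "e i = e j \<longleftrightarrow> i = j"
    using assms by (auto simp: bij_betw_def inj_on_def)
  then show ?thesis
    by (simp add: inner_Basis)
qed

text \<open>Multiplying the last coordinate by \<open>\<bar>x k\<bar>\<close>, after the perturbation above, deforms an odd map into one that
  preserves the equator, to which the degree step of the library applies. The Euclidean space \<open>'a\<close>
  only serves as a home for the measure-theoretic argument in every dimension up to \<open>DIM('a)\<close>.\<close>

lemma odd_Brouwer_degree2_of_odd_map:
  fixes e :: "nat \<Rightarrow> 'a::euclidean_space"
  assumes e: "bij_betw e {..<DIM('a)} Basis"
  shows "k < DIM('a) \<Longrightarrow> continuous_on (std_sphere k) f \<Longrightarrow> f \<in> std_sphere k \<rightarrow> std_sphere k \<Longrightarrow>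
    (\<And>x. x \<in> std_sphere k \<Longrightarrow> f (\<lambda>i. - x i) = (\<lambda>i. - f x i)) \<Longrightarrow> odd (Brouwer_degree2 k f)"
proof (induction k arbitrary: f)
  case 0
  \<comment> \<open>The sphere of dimension 0 is one antipodal pair, so an odd self-map is the
    identity or the reflection, of degree 1 or -1.\<close>
  let ?s = "\<lambda>x::nat \<Rightarrow> real. \<lambda>i. if i = 0 then - x i else x i"
  define u where "u = (\<lambda>i::nat. if i = 0 then 1 else 0 :: real)"
  have std_sphere0: "x = u \<or> x = (\<lambda>i. - u i)" if "x \<in> std_sphere 0" for x
    using that by (auto simp: std_sphere_def u_def fun_eq_iff power2_eq_1_iff)
  have u: "u \<in> std_sphere 0"
    by (auto simp: std_sphere_def u_def)
  then have "f u = u \<or> f u = (\<lambda>i. - u i)"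
    using 0(3) std_sphere0 by blast
  then consider "\<And>x. x \<in> std_sphere 0 \<Longrightarrow> f x = id x" | "\<And>x. x \<in> std_sphere 0 \<Longrightarrow> f x = ?s x"
  proof
    assume "f u = u"
    then have "f x = id x" if "x \<in> std_sphere 0" for x
      using std_sphere0 [OF that] 0(4) [OF u] by auto
    then show thesis using that by blast
  next
    assume "f u = (\<lambda>i. - u i)"
    then have "f x = (\<lambda>i. - x i)" if "x \<in> std_sphere 0" for x
      using std_sphere0 [OF that] 0(4) [OF u] by auto
    moreover have "(\<lambda>i. - x i) = ?s x" if "x \<in> std_sphere 0" for x
      using that by (auto simp: std_sphere_def fun_eq_iff)
    ultimately have "f x = ?s x" if "x \<in> std_sphere 0" for x
      using that by metis
    then show thesis using that by blast
  qed
  then show ?case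
  proof cases
    case 1
    then have "Brouwer_degree2 0 f = Brouwer_degree2 0 id"
      by (intro Brouwer_degree2_eq) (auto simp: topspace_nsphere_eq)
    then show ?thesis by simp
  next
    case 2
    then have "Brouwer_degree2 0 f = Brouwer_degree2 0 ?s"
      by (intro Brouwer_degree2_eq) (auto simp: topspace_nsphere_eq)
    then show ?thesis by (simp add: Brouwer_degree2_reflection)
  qed
next
  case (Suc m)
  define k where "k = Suc m"
  have k: "k < DIM('a)" and m: "m < DIM('a)"
    using Suc.prems by (auto simp: k_def)
  have f: "continuous_on (std_sphere k) f" "f \<in> std_sphere k \<rightarrow> std_sphere k"
    and fodd: "\<And>x. x \<in> std_sphere k \<Longrightarrow> f (\<lambda>i. - x i) = (\<lambda>i. - f x i)"
    using Suc.prems by (auto simp: k_def)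
  have eB: "e i \<in> Basis" if "i \<le> k" for i
    using e k that by (auto simp: bij_betw_def)
  have ee: "e i \<bullet> e j = (if i = j then 1 else 0)" if "i \<le> k" "j \<le> k" for i j
    using inner_enumerated_Basis [OF e] k that by simp
  \<comment> \<open>\<open>emb\<close> and \<open>res\<close> identify \<open>std_sphere k\<close>
    with the unit sphere \<open>S\<close> of the span of \<open>e 0, ..., e k\<close>, where the
    perturbation is carried out.\<close>
  define emb where "emb = (\<lambda>x. \<Sum>i\<le>k. x i *\<^sub>R e i)"
  define res where "res = (\<lambda>u i. if i \<le> k then u \<bullet> e i else 0)"
  define B where "B = e ` {..<k}"
  define S where "S = {x \<in> sphere 0 1. \<forall>i\<in>Basis - insert (e k) B. x \<bullet> i = 0}"
  have insB: "insert (e k) B = e ` {..k}"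
    by (auto simp: B_def image_iff le_less)
  have injk: "inj_on e {..k}"
    using e k by (auto simp: bij_betw_def inj_on_def)
  have BB: "insert (e k) B \<subseteq> Basis"
    unfolding insB using eB by auto
  have kB: "e k \<notin> B"
  proof
    assume "e k \<in> B"
    then obtain i where "i < k" "e i = e k"
      by (auto simp: B_def)
    then show False
      using inj_onD [OF injk, of i k] by simp
  qed
  have emb_inner: "emb x \<bullet> e i = x i" if "i \<le> k" for x i
  proof -
    have "emb x \<bullet> e i = (\<Sum>j\<le>k. if j = i then x j else 0)"
      unfolding emb_def inner_sum_left using that by (intro sum.cong) (auto simp: ee)
    then show ?thesis
      using that by simp
  qed
  have emb_inner0: "emb x \<bullet> i = 0" if "i \<in> Basis - insert (e k) B" for x i
    unfolding emb_def inner_sum_left using that eB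
    by (intro sum.neutral) (auto simp: inner_Basis insB)
  have emb_norm: "(norm (emb x))\<^sup>2 = (\<Sum>i\<le>k. (x i)\<^sup>2)" for x
  proof -
    have "emb x \<bullet> emb x = (\<Sum>i\<le>k. x i * (emb x \<bullet> e i))"
      by (subst (2) emb_def) (simp add: inner_sum_right)
    also have "\<dots> = (\<Sum>i\<le>k. (x i)\<^sup>2)"
      by (intro sum.cong) (auto simp: emb_inner power2_eq_square)
    finally show ?thesis
      by (simp add: dot_square_norm)
  qed
  have emb_S: "emb x \<in> S" if "x \<in> std_sphere k" for x
  proof -
    have "(norm (emb x))\<^sup>2 = 1"
      using that by (simp add: emb_norm std_sphere_def)
    then have "norm (emb x) = 1"
      by (simp add: power2_eq_1_iff) (smt (verit) norm_ge_zero)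
    then show ?thesis
      by (auto simp: S_def emb_inner0)
  qed
  have res_emb: "res (emb x) = x" if "x \<in> std_sphere k" for x
    using that by (auto simp: res_def emb_inner std_sphere_def fun_eq_iff)
  have res_S: "res u \<in> std_sphere k" if "u \<in> S" for u
  proof -
    have "1 = u \<bullet> u"
      using that by (simp add: S_def dot_square_norm)
    also have "\<dots> = (\<Sum>i\<in>Basis. (u \<bullet> i)\<^sup>2)"
      by (subst euclidean_inner) (simp add: power2_eq_square)
    also have "\<dots> = (\<Sum>i\<in>e ` {..k}. (u \<bullet> i)\<^sup>2)"
      using that BB by (intro sum.mono_neutral_right) (auto simp: S_def insB)
    also have "\<dots> = (\<Sum>i\<le>k. (u \<bullet> e i)\<^sup>2)"
      using injk by (simp add: sum.reindex)
    finally show ?thesis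
      by (auto simp: std_sphere_def res_def)
  qed
  have cont_emb: "continuous_on A emb" for A
    unfolding emb_def by (intro continuous_intros)
  have cont_res: "continuous_on A res" for A
    unfolding res_def
  proof (rule continuous_on_coordinatewise_then_product)
    show "continuous_on A (\<lambda>x. if i \<le> k then x \<bullet> e i else 0)" for i
      by (cases "i \<le> k") (auto intro!: continuous_intros)
  qed
  define fE where "fE = (\<lambda>u. emb (f (res u)))"
  have 1: "continuous_on S fE"
    unfolding fE_def
    by (rule continuous_on_compose2 [OF cont_emb continuous_on_compose2 [OF f(1) cont_res]]) (use res_S in auto)
  have 2: "fE \<in> S \<rightarrow> S"
    using emb_S res_S f(2) by (auto simp: fE_def)
  have 3: "fE (- u) = - fE u" if "u \<in> S" for u
  proof -
    have "res (- u) = (\<lambda>i. - res u i)"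
      by (auto simp: res_def)
    then have "f (res (- u)) = (\<lambda>i. - f (res u) i)"
      using fodd res_S [OF that] by simp
    then show ?thesis
      by (simp add: fE_def emb_def sum_negf)
  qed
  \<comment> \<open>Small enough that \<open>k\<close> coordinates of size at most
    \<open>\<epsilon>\<close> cannot make up a unit vector:
    \<open>k * \<epsilon>\<^sup>2 < 1\<close>.\<close>
  define \<epsilon> where "\<epsilon> = 1 / (real k + 1)"
  have "\<epsilon> > 0"
    by (simp add: \<epsilon>_def)
  obtain F where F: "continuous_on S F" "\<And>x. F (- x) = - F x"
    "\<And>x. x \<in> S \<Longrightarrow> norm (fE x - F x) < \<epsilon>"
    "\<And>x. x \<in> S \<Longrightarrow> x \<bullet> e k = 0 \<Longrightarrow> \<exists>i\<in>B. F x \<bullet> i \<noteq> 0"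
    using odd_general_position [OF _ _ kB \<open>\<epsilon> > 0\<close> S_def 1 2 3] BB by blast
  \<comment> \<open>The factor \<open>\<bar>x k\<bar>\<close> is even, so the last coordinate stays
    odd, and at time 1 it vanishes on the equator. The other coordinates move to those of
    \<open>F\<close>, which do not all vanish there.\<close>
  define H where "H = (\<lambda>t x i. if i < k then (1 - t) * f x i + t * (F (emb x) \<bullet> e i)
     else if i = k then ((1 - t) + t * \<bar>x k\<bar>) * f x k else 0 :: real)"
  define G where "G = (\<lambda>x. normalized k (H 1 x))"
  have nz: "\<exists>i\<le>k. H t x i \<noteq> 0" if t: "t \<in> {0..1}" and x: "x \<in> std_sphere k" for t x
  proof (rule ccontr)
    assume "\<not> ?thesis"
    then have 0: "\<And>i. i \<le> k \<Longrightarrow> H t x i = 0"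
      by blast
    show False
    proof (cases "t = 1 \<and> x k = 0")
      case True
      then have "emb x \<bullet> e k = 0"
        by (simp add: emb_inner)
      then obtain i where "i < k" "F (emb x) \<bullet> e i \<noteq> 0"
        using F(4) [OF emb_S [OF x]] by (auto simp: B_def)
      then show False
        using 0 [of i] True by (simp add: H_def)
    next
      \<comment> \<open>The factor of the last coordinate is positive here, so
        \<open>f x k = 0\<close>; a zero of the other coordinates would then force all of
        \<open>f x\<close> to be too small for a unit vector.\<close>
      case False
      have "(1 - t) + t * \<bar>x k\<bar> > 0"
      proof (cases "t = 1")
        case False
        then show ?thesis using t by (intro add_pos_nonneg) auto
      qed (use False in auto)
      then have fk: "f x k = 0"
        using 0 [of k] by (simp add: H_def)
      have fi: "(f x i)\<^sup>2 \<le> \<epsilon>\<^sup>2" if i: "i < k" for i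
      proof -
        have "f x i - F (emb x) \<bullet> e i = (fE (emb x) - F (emb x)) \<bullet> e i"
          using i x by (simp add: fE_def res_emb emb_inner inner_diff_left)
        then have le: "\<bar>f x i - F (emb x) \<bullet> e i\<bar> \<le> \<epsilon>"
          using Basis_le_norm [of "e i" "fE (emb x) - F (emb x)"] eB [of i] i F(3) [OF emb_S [OF x]] by simp
        have "f x i = t * (f x i - F (emb x) \<bullet> e i)"
          using 0 [of i] i by (simp add: H_def algebra_simps)
        then have "\<bar>f x i\<bar> = t * \<bar>f x i - F (emb x) \<bullet> e i\<bar>"
          using t by (metis abs_mult abs_of_nonneg atLeastAtMost_iff)
        also have "\<dots> \<le> 1 * \<epsilon>"
          using t le by (intro mult_mono) auto
        finally show ?thesis
          using \<open>\<epsilon> > 0\<close> by (intro power2_le_iff_abs_le[THEN iffD2]) auto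
      qed
      have "1 = (\<Sum>i\<le>k. (f x i)\<^sup>2)"
        using f(2) x by (auto simp: std_sphere_def Pi_iff)
      also have "\<dots> = (\<Sum>i<k. (f x i)\<^sup>2)"
        by (simp add: fk flip: lessThan_Suc_atMost)
      also have "\<dots> \<le> (\<Sum>i<k. \<epsilon>\<^sup>2)"
        by (intro sum_mono) (use fi in auto)
      also have "\<dots> = real k / (real k + 1)\<^sup>2"
        by (simp add: \<epsilon>_def power_divide)
      also have "\<dots> < 1"
        by (simp add: power2_eq_square algebra_simps divide_less_eq add_pos_nonneg)
      finally show False by simp
    qed
  qed
  have fcoord: "continuous_on (std_sphere k) (\<lambda>x. f x i)" for i
    using f(1) by (rule continuous_on_product_then_coordinatewise)
  have Femb: "continuous_on (std_sphere k) (\<lambda>x. F (emb x))"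
    by (rule continuous_on_compose2 [OF F(1) cont_emb]) (use emb_S in auto)
  have cH: "continuous_on ({0..1::real} \<times> std_sphere k) (\<lambda>p. H (fst p) (snd p) i)" for i
  proof -
    have snd: "continuous_on ({0..1::real} \<times> std_sphere k) (\<lambda>p. snd p)"
      by (rule continuous_on_snd [OF continuous_on_id])
    have f': "continuous_on ({0..1::real} \<times> std_sphere k) (\<lambda>p. f (snd p) i)" for i
      by (rule continuous_on_compose2 [OF fcoord snd]) auto
    have F': "continuous_on ({0..1::real} \<times> std_sphere k) (\<lambda>p. F (emb (snd p)))"
      by (rule continuous_on_compose2 [OF Femb snd]) auto
    have x': "continuous_on ({0..1::real} \<times> std_sphere k) (\<lambda>p. snd p k)"
      by (rule continuous_on_compose2 [OF continuous_on_coordinate [of UNIV] snd]) auto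
    consider "i < k" | "i = k" | "i > k" by linarith
    then show ?thesis
      by cases (auto simp: H_def intro!: continuous_intros f' F' x')
  qed
  have "homotopic_with (\<lambda>x. True) (nsphere k) (nsphere k) f G"
    unfolding G_def
  proof (rule homotopic_with_normalized [OF f(2) cH _ nz])
    show "H 0 x = f x" if "x \<in> std_sphere k" for x
      using f(2) that by (auto simp: H_def std_sphere_def fun_eq_iff Pi_iff)
  qed (auto simp: H_def)
  then have deg: "Brouwer_degree2 k f = Brouwer_degree2 k G" and cG: "continuous_map (nsphere k) (nsphere k) G"
    by (auto dest: Brouwer_degree2_homotopic homotopic_with_imp_continuous_maps)
  have oddG: "G (\<lambda>i. - x i) = (\<lambda>i. - G x i)" if "x \<in> std_sphere k" for x
  proof -
    have "emb (\<lambda>i. - x i) = - emb x"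
      by (simp add: emb_def sum_negf)
    then have "H 1 (\<lambda>i. - x i) = (\<lambda>i. - H 1 x i)"
      using fodd [OF that] F(2) by (auto simp: H_def fun_eq_iff)
    then show ?thesis
      by (simp add: G_def normalized_def)
  qed
  have sub: "std_sphere m \<subseteq> std_sphere k"
    by (auto simp: std_sphere_def k_def)
  have Gm: "G \<in> std_sphere m \<rightarrow> std_sphere m"
  proof
    fix x assume x: "x \<in> std_sphere m"
    then have "x \<in> std_sphere k" "x k = 0"
      using sub by (auto simp: std_sphere_def k_def)
    then have "G x \<in> std_sphere k" "G x k = 0"
      using cG by (auto simp: continuous_map_nsphere_iff) (simp add: G_def normalized_def H_def)
    then show "G x \<in> std_sphere m"
      by (auto simp: std_sphere_def k_def not_less_eq) (metis Suc_lessI)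
  qed
  have "continuous_on (std_sphere m) G"
    using cG sub by (auto simp: continuous_map_nsphere_iff intro: continuous_on_subset)
  then have "odd (Brouwer_degree2 m G)"
    using m Gm oddG sub by (intro Suc.IH) auto
  \<comment> \<open>\<open>G\<close> is odd and preserves the equator, so its degrees there and on
    the whole sphere have equal parity.\<close>
  moreover have "even (Brouwer_degree2 k G - Brouwer_degree2 (k - Suc 0) G)"
  proof (rule Borsuk_odd_mapping_degree_step [OF cG])
    show "(G \<circ> (\<lambda>x i. - x i)) u = ((\<lambda>x i. - x i) \<circ> G) u" if "u \<in> topspace (nsphere k)" for u
      using that oddG by (simp add: topspace_nsphere_eq)
    show "G \<in> topspace (nsphere (k - Suc 0)) \<rightarrow> topspace (nsphere (k - Suc 0))"
      using Gm by (simp add: k_def topspace_nsphere_eq)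
  qed
  ultimately show ?case
    using deg by (simp add: k_def)
qed

text \<open>Fewer than \<open>DIM('a)\<close> odd functions without common zero, padded with zeros
  and normalized, would form an odd self-map of the unit sphere whose last coordinate vanishes. It
  misses a pole and has degree 0, whereas odd maps have odd degree.\<close>

lemma Borsuk_Ulam:
  fixes h :: "nat \<Rightarrow> 'a::euclidean_space \<Rightarrow> real"
  assumes cont: "\<And>i. i < m \<Longrightarrow> continuous_on (sphere 0 1) (h i)"
    and odd: "\<And>i u. i < m \<Longrightarrow> u \<in> sphere 0 1 \<Longrightarrow> h i (- u) = - h i u"
    and nz: "\<And>u. u \<in> sphere 0 1 \<Longrightarrow> \<exists>i<m. h i u \<noteq> 0"
  shows "DIM('a) \<le> m"
proof (rule ccontr)
  assume "\<not> ?thesis"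
  then have m: "m < DIM('a)" by simp
  obtain e :: "nat \<Rightarrow> 'a" where e: "bij_betw e {..<DIM('a)} Basis"
    using ex_bij_betw_nat_finite [of "Basis :: 'a set"] by (auto simp: atLeast0LessThan)
  define k where "k = DIM('a) - 1"
  have k: "DIM('a) = Suc k"
    using DIM_positive [where 'a = 'a] by (simp add: k_def)
  have ee: "e j \<bullet> e i = (if j = i then 1 else 0)" if "i \<le> k" "j \<le> k" for i j
    using inner_enumerated_Basis [OF e] k that by simp
  define emb where "emb = (\<lambda>x. \<Sum>i\<le>k. x i *\<^sub>R e i)"
  have emb_S: "emb x \<in> sphere 0 1" if "x \<in> std_sphere k" for x
  proof -
    have "emb x \<bullet> emb x = (\<Sum>i\<le>k. x i * (\<Sum>j\<le>k. x j * (e j \<bullet> e i)))"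
      by (simp add: emb_def inner_sum_left inner_sum_right sum_distrib_left inner_commute mult.left_commute)
    also have "\<dots> = (\<Sum>i\<le>k. x i * (\<Sum>j\<le>k. if j = i then x j else 0))"
      by (intro sum.cong arg_cong2 [where f = "(*)"] refl) (auto simp: ee)
    also have "\<dots> = 1"
      using that by (simp add: std_sphere_def power2_eq_square)
    finally show ?thesis
      by (simp add: norm_eq_1)
  qed
  have cont_emb: "continuous_on A emb" for A
    unfolding emb_def by (intro continuous_intros)
  define v where "v = (\<lambda>x i. if i < m then h i (emb x) else 0)"
  define f where "f = (\<lambda>x. normalized k (v x))"
  have v: "\<exists>i\<le>k. v x i \<noteq> 0" "\<And>i. i > k \<Longrightarrow> v x i = 0" if "x \<in> std_sphere k" for x
    using nz [OF emb_S [OF that]] m k by (auto simp: v_def)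
  have f: "f \<in> std_sphere k \<rightarrow> std_sphere k"
    using v by (auto simp: f_def intro: normalized_in_std_sphere)
  have "continuous_on (std_sphere k) (\<lambda>x. v x i)" for i
  proof (cases "i < m")
    case True
    then have "continuous_on (std_sphere k) (\<lambda>x. h i (emb x))"
      by (intro continuous_on_compose2 [OF cont cont_emb]) (use emb_S in auto)
    then show ?thesis
      using True by (simp add: v_def)
  qed (simp add: v_def)
  then have cf: "continuous_on (std_sphere k) f"
    unfolding f_def using v by (intro continuous_on_normalized) auto
  have "f (\<lambda>i. - x i) = (\<lambda>i. - f x i)" if "x \<in> std_sphere k" for x
  proof -
    have "emb (\<lambda>i. - x i) = - emb x"
      by (simp add: emb_def sum_negf)
    then have "v (\<lambda>i. - x i) = (\<lambda>i. - v x i)"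
      using odd [OF _ emb_S [OF that]] by (auto simp: v_def fun_eq_iff)
    then show ?thesis
      by (simp add: f_def normalized_def)
  qed
  then have "odd (Brouwer_degree2 k f)"
    using k by (intro odd_Brouwer_degree2_of_odd_map [OF e] cf f) auto
  moreover have "Brouwer_degree2 k f = 0"
  proof (rule Brouwer_degree2_nonsurjective)
    show "continuous_map (nsphere k) (nsphere k) f"
      using cf f by (simp add: continuous_map_nsphere_iff)
    define w where "w = (\<lambda>i. if i = k then 1 else 0 :: real)"
    have "w \<in> std_sphere k"
      by (auto simp: w_def std_sphere_def if_distrib [of "\<lambda>x. x\<^sup>2"] cong: if_cong)
    moreover have "f x \<noteq> w" for x
    proof
      assume "f x = w"
      then have "f x k = w k" by simp
      then show False
        using m k by (simp add: f_def normalized_def v_def w_def)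
    qed
    ultimately show "f ` topspace (nsphere k) \<noteq> topspace (nsphere k)"
      by (metis imageE topspace_nsphere_eq)
  qed
  ultimately show False by simp
qed

section \<open>Sublevel sets of even homogeneous functions\<close>

text \<open>The condition says that \<open>X\<close> has Krasnoselskii genus at most \<open>k\<close>; taking the functions on the whole sphere
  avoids extension arguments.\<close>

definition odd_nonvanishing :: "nat \<Rightarrow> 'a::euclidean_space set \<Rightarrow> bool" where
  "odd_nonvanishing k X \<longleftrightarrow> (\<exists>h :: nat \<Rightarrow> 'a \<Rightarrow> real.
     (\<forall>i<k. continuous_on (sphere 0 1) (h i) \<and> (\<forall>u\<in>sphere 0 1. h i (- u) = - h i u)) \<and>
     (\<forall>u\<in>X. \<exists>i<k. h i u \<noteq> 0))"

lemma odd_nonvanishing_mono: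
  assumes "odd_nonvanishing k X" "k \<le> l" "Y \<subseteq> X"
  shows "odd_nonvanishing l Y"
proof -
  obtain h :: "nat \<Rightarrow> 'a \<Rightarrow> real" where
    "\<forall>i<k. continuous_on (sphere 0 1) (h i) \<and> (\<forall>u\<in>sphere 0 1. h i (- u) = - h i u)"
    "\<forall>u\<in>X. \<exists>i<k. h i u \<noteq> 0"
    using assms(1) by (auto simp: odd_nonvanishing_def)
  then show ?thesis
    unfolding odd_nonvanishing_def using assms(2,3)
    by (intro exI [of _ "\<lambda>i. if i < k then h i else (\<lambda>_. 0)"]) (fastforce simp: less_le_trans)
qed

lemma odd_nonvanishing_empty: "odd_nonvanishing k {}"
  unfolding odd_nonvanishing_def by (intro exI [of _ "\<lambda>_ _. 0"]) auto

text \<open>Composition with \<open>\<phi>\<close> pulls the functions back; \<open>\<phi>\<close>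
  has to be continuous and odd on the whole sphere because the functions are required to be
  so.\<close>

lemma odd_nonvanishing_vimage:
  assumes "odd_nonvanishing k Y" and \<phi>: "continuous_on (sphere 0 1) \<phi>" "\<phi> \<in> sphere 0 1 \<rightarrow> sphere 0 1"
    "\<And>u. u \<in> sphere 0 1 \<Longrightarrow> \<phi> (- u) = - \<phi> u" and "\<phi> \<in> X \<rightarrow> Y"
  shows "odd_nonvanishing k X"
proof -
  obtain h :: "nat \<Rightarrow> 'a \<Rightarrow> real" where h:
    "\<And>i. i < k \<Longrightarrow> continuous_on (sphere 0 1) (h i)"
    "\<And>i u. i < k \<Longrightarrow> u \<in> sphere 0 1 \<Longrightarrow> h i (- u) = - h i u"
    "\<And>u. u \<in> Y \<Longrightarrow> \<exists>i<k. h i u \<noteq> 0"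
    using assms(1) unfolding odd_nonvanishing_def by blast
  have "continuous_on (sphere 0 1) (\<lambda>u. h i (\<phi> u))" if "i < k" for i
    using continuous_on_compose2 [OF h(1) [OF that] \<phi>(1)] \<phi>(2) by auto
  moreover have "h i (\<phi> (- u)) = - h i (\<phi> u)" if "i < k" "u \<in> sphere 0 1" for i u
    using h(2) [OF that(1)] \<phi>(2,3) that(2) by (metis Pi_iff)
  ultimately show ?thesis
    unfolding odd_nonvanishing_def using h(3) assms(5)
    by (intro exI [of _ "\<lambda>i u. h i (\<phi> u)"]) (auto simp: Pi_iff)
qed

text \<open>The additional function \<open>h0\<close> takes care of every point of \<open>X\<close>
  outside its own zero set.\<close>

lemma odd_nonvanishing_Suc:
  fixes h0 :: "'a::euclidean_space \<Rightarrow> real"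
  assumes "odd_nonvanishing k (X \<inter> {u. h0 u = 0})"
    and h0: "continuous_on (sphere 0 1) h0" "\<And>u. u \<in> sphere 0 1 \<Longrightarrow> h0 (- u) = - h0 u"
  shows "odd_nonvanishing (Suc k) X"
proof -
  obtain h :: "nat \<Rightarrow> 'a \<Rightarrow> real" where
    h: "\<forall>i<k. continuous_on (sphere 0 1) (h i) \<and> (\<forall>u\<in>sphere 0 1. h i (- u) = - h i u)"
    "\<forall>u\<in>X \<inter> {u. h0 u = 0}. \<exists>i<k. h i u \<noteq> 0"
    using assms(1) by (auto simp: odd_nonvanishing_def)
  let ?h = "h(k := h0)"
  have "\<exists>i<Suc k. ?h i u \<noteq> 0" if u: "u \<in> X" for u
  proof (cases "h0 u = 0")
    case True
    then obtain i where "i < k" "h i u \<noteq> 0"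
      using h(2) u by blast
    then show ?thesis
      by (intro exI [of _ i]) auto
  qed auto
  then show ?thesis
    unfolding odd_nonvanishing_def using h(1) h0
    by (intro exI [of _ ?h]) (auto simp: less_Suc_eq)
qed

text \<open>Finitely many hyperplanes are negligible and cannot cover the space. Applied to the
  critical points, this yields one odd function that is nonzero at all of them.\<close>

lemma ex_nonorthogonal:
  fixes K :: "'a::euclidean_space set"
  assumes "finite K" "0 \<notin> K"
  obtains v where "\<And>x. x \<in> K \<Longrightarrow> v \<bullet> x \<noteq> 0"
proof -
  have "negligible (\<Union>x\<in>K. {v. x \<bullet> v = 0})"
    using assms by (intro negligible_Union) (auto intro!: negligible_hyperplane)
  then obtain v where "v \<notin> (\<Union>x\<in>K. {v. x \<bullet> v = 0})"
    by (metis UNIV_eq_I non_negligible_UNIV)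
  then show thesis
    using that [of v] by (auto simp: inner_commute)
qed

section \<open>Gradient descent on the sphere\<close>

text \<open>As \<open>F\<close> is constant on open rays, its gradient \<open>G\<close> is tangent
  to the sphere, so the critical points of the restriction to the sphere are the zeros of
  \<open>G\<close> there. The origin is excluded because a non-constant \<open>F\<close> cannot be
  continuous at it.\<close>

locale even_homogeneous =
  fixes F :: "'a::euclidean_space \<Rightarrow> real" and G :: "'a \<Rightarrow> 'a"
  assumes deriv: "\<And>x. x \<noteq> 0 \<Longrightarrow> (F has_derivative (\<lambda>h. G x \<bullet> h)) (at x)"
    and cont_G: "continuous_on (- {0}) G"
    and homogeneous: "\<And>r x. r > 0 \<Longrightarrow> F (r *\<^sub>R x) = F x"
    and even: "\<And>x. F (- x) = F x"
begin

lemma odd_G: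
  assumes "x \<noteq> 0"
  shows "G (- x) = - G x"
proof -
  have "((\<lambda>y. F (- y)) has_derivative (\<lambda>h. G (- x) \<bullet> (- h))) (at x)"
    by (rule has_derivative_compose [of uminus uminus, OF _ deriv])
      (use assms in \<open>auto intro!: derivative_eq_intros\<close>)
  then have "(F has_derivative (\<lambda>h. G (- x) \<bullet> (- h))) (at x)"
    by (simp add: even)
  then have "(\<lambda>h. G (- x) \<bullet> (- h)) = (\<lambda>h. G x \<bullet> h)"
    using deriv [OF assms] by (rule has_derivative_unique)
  then have "G (- x) \<bullet> h = (- G x) \<bullet> h" for h
    by (metis inner_minus_left inner_minus_right minus_minus)
  then show ?thesis
    using vector_eq_rdot by blast
qed

lemma cont_F: "continuous_on (- {0}) F"
  using has_derivative_continuous [OF deriv] by (intro continuous_at_imp_continuous_on) auto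

lemma cont_F_sphere: "continuous_on (sphere 0 1) F"
  by (rule continuous_on_subset [OF cont_F]) auto

lemma cont_G_sphere: "continuous_on (sphere 0 1) G"
  by (rule continuous_on_subset [OF cont_G]) auto

text \<open>A single discrete gradient step replaces the flow, which need not exist for a merely continuous
  gradient. Homogeneity allows us to return to the sphere without changing \<open>F\<close>.\<close>

lemma descent:
  assumes "\<delta> > 0"
  obtains \<phi> \<kappa> where "\<kappa> > 0" "continuous_on (sphere 0 1) \<phi>" "\<phi> \<in> sphere 0 1 \<rightarrow> sphere 0 1"
    "\<And>u. u \<in> sphere 0 1 \<Longrightarrow> \<phi> (- u) = - \<phi> u"
    "\<And>u. u \<in> sphere 0 1 \<Longrightarrow> F (\<phi> u) \<le> F u"
    "\<And>u. u \<in> sphere 0 1 \<Longrightarrow> norm (G u) \<ge> \<delta> \<Longrightarrow> F (\<phi> u) \<le> F u - \<kappa>"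
proof -
  define d where "d = \<delta> / 2"
  have d: "d > 0" using assms by (simp add: d_def)
  obtain M where M: "M > 0" "\<And>u. u \<in> sphere 0 1 \<Longrightarrow> norm (G u) \<le> M"
    using compact_imp_bounded [OF compact_continuous_image [OF cont_G_sphere compact_sphere]]
    by (force simp: bounded_pos)
  \<comment> \<open>A compact shell that avoids the origin and will contain every segment from
    \<open>u\<close> to \<open>\<psi> u\<close>, so that \<open>G\<close> is uniformly continuous
    along all steps.\<close>
  define A where "A = cball 0 (3/2) - ball (0::'a) (1/2)"
  have "compact A"
    unfolding A_def by (intro compact_diff) auto
  moreover have "continuous_on A G"
    by (rule continuous_on_subset [OF cont_G]) (auto simp: A_def)
  ultimately have "uniformly_continuous_on A G"
    by (rule compact_uniformly_continuous [rotated])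
  then obtain \<eta> where \<eta>: "\<eta> > 0" "\<And>x y. x \<in> A \<Longrightarrow> y \<in> A \<Longrightarrow> dist y x < \<eta> \<Longrightarrow> dist (G y) (G x) < d / 2"
    using d unfolding uniformly_continuous_on_def by (meson half_gt_zero)
  \<comment> \<open>Displacements will be at most \<open>t * M\<^sup>2\<close>; the minimum keeps
    them inside the shell and below the modulus \<open>\<eta>\<close>.\<close>
  define t where "t = min (1/2) (\<eta>/2) / M\<^sup>2"
  have t: "t > 0" "t * M\<^sup>2 \<le> 1/2" "t * M\<^sup>2 < \<eta>"
    using \<eta>(1) M(1) by (auto simp: t_def)
  \<comment> \<open>No step is taken where \<open>norm (G u) \<le> d\<close>. Elsewhere the
    variation of \<open>G\<close> along the step, less than \<open>d / 2\<close>, is below half of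
    \<open>norm (G u)\<close>, so the direction remains one of descent.\<close>
  define s where "s = (\<lambda>u. t * max 0 (norm (G u) - d))"
  have s: "s u \<ge> 0" "s u * norm (G u) \<le> t * M\<^sup>2" if "u \<in> sphere 0 1" for u
  proof -
    show "s u \<ge> 0" using t by (simp add: s_def)
    have "max 0 (norm (G u) - d) * norm (G u) \<le> M * M"
      using M(2) [OF that] M(1) d by (intro mult_mono) auto
    then show "s u * norm (G u) \<le> t * M\<^sup>2"
      using t(1) by (simp add: s_def power2_eq_square mult.assoc)
  qed
  define \<psi> where "\<psi> = (\<lambda>u. u - s u *\<^sub>R G u)"
  define \<phi> where "\<phi> = (\<lambda>u. (1 / norm (\<psi> u)) *\<^sub>R \<psi> u)"
  have near: "norm (\<tau> *\<^sub>R G u) \<le> t * M\<^sup>2" if "u \<in> sphere 0 1" "0 \<le> \<tau>" "\<tau> \<le> s u" for u \<tau>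
  proof -
    have "\<tau> * norm (G u) \<le> s u * norm (G u)"
      using that(3) by (rule mult_right_mono) simp
    then show ?thesis
      using s(2) [OF that(1)] that(2) by simp
  qed
  have inA: "u - \<tau> *\<^sub>R G u \<in> A" if "u \<in> sphere 0 1" "0 \<le> \<tau>" "\<tau> \<le> s u" for u \<tau>
    using near [OF that] t that(1) norm_triangle_ineq2 [of u "\<tau> *\<^sub>R G u"] norm_triangle_ineq4 [of u "\<tau> *\<^sub>R G u"]
    by (auto simp: A_def)
  have \<psi>0: "\<psi> u \<noteq> 0" if "u \<in> sphere 0 1" for u
    using inA [OF that, of "s u"] s(1) [OF that] by (auto simp: \<psi>_def A_def)
  have F\<phi>: "F (\<phi> u) = F (\<psi> u)" if "u \<in> sphere 0 1" for u
    unfolding \<phi>_def using \<psi>0 [OF that] by (intro homogeneous) auto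
  have F\<psi>: "F (\<psi> u) \<le> F u - s u * (norm (G u))\<^sup>2 / 2" if u: "u \<in> sphere 0 1" for u
  proof (cases "s u = 0")
    case False
    then have su: "s u > 0" "norm (G u) > d"
      using s(1) [OF u] by (auto simp: s_def max_def less_le split: if_splits)
    have D: "((\<lambda>\<tau>. F (u - \<tau> *\<^sub>R G u)) has_derivative (\<lambda>h. G (u - \<tau> *\<^sub>R G u) \<bullet> (- (h *\<^sub>R G u)))) (at \<tau>)"
      if "0 \<le> \<tau>" "\<tau> \<le> s u" for \<tau>
      by (rule has_derivative_compose [of "\<lambda>\<tau>. u - \<tau> *\<^sub>R G u", OF _ deriv])
        (use inA [OF u that] in \<open>auto simp: A_def intro!: derivative_eq_intros\<close>)
    have "((\<lambda>\<tau>. F (u - \<tau> *\<^sub>R G u)) has_real_derivative - (G (u - \<tau> *\<^sub>R G u) \<bullet> G u)) (at \<tau>)"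
      if "0 \<le> \<tau>" "\<tau> \<le> s u" for \<tau>
      unfolding has_field_derivative_def using D [OF that]
      by (rule has_derivative_eq_rhs) (simp add: fun_eq_iff mult.commute)
    from MVT2 [OF su(1) this] obtain \<tau> where \<tau>: "0 < \<tau>" "\<tau> < s u"
      and eq: "F (\<psi> u) - F u = s u * - (G (u - \<tau> *\<^sub>R G u) \<bullet> G u)"
      by (auto simp: \<psi>_def)
    let ?y = "u - \<tau> *\<^sub>R G u"
    have "dist (G ?y) (G u) < d / 2"
    proof (rule \<eta>(2))
      show "u \<in> A" "?y \<in> A"
        using inA [OF u, of 0] inA [OF u, of \<tau>] s(1) [OF u] \<tau> by auto
      show "dist ?y u < \<eta>"
        using near [OF u, of \<tau>] \<tau> t by (simp add: dist_norm)
    qed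
    then have "\<bar>(G ?y - G u) \<bullet> G u\<bar> \<le> d / 2 * norm (G u)"
      using Cauchy_Schwarz_ineq2 [of "G ?y - G u" "G u"]
      by (smt (verit) dist_norm mult_right_mono norm_ge_zero)
    also have "\<dots> \<le> norm (G u) / 2 * norm (G u)"
      using su by (intro mult_right_mono) auto
    finally have "- (norm (G u) / 2 * norm (G u)) \<le> (G ?y - G u) \<bullet> G u"
      by (simp only: abs_le_iff) linarith
    then have "G ?y \<bullet> G u \<ge> (norm (G u))\<^sup>2 / 2"
      by (simp add: inner_diff_left dot_square_norm power2_eq_square)
    then have "s u * ((norm (G u))\<^sup>2 / 2) \<le> s u * (G ?y \<bullet> G u)"
      using su by (intro mult_left_mono) auto
    then show ?thesis
      using eq by simp
  qed (simp add: \<psi>_def)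
  show thesis
  proof
    \<comment> \<open>The witness for \<open>\<kappa>\<close>: where
      \<open>norm (G u) \<ge> \<delta>\<close>, the cut-off leaves
      \<open>s u \<ge> t * d\<close>.\<close>
    show "t * d * \<delta>\<^sup>2 / 2 > 0"
      using t d assms by simp
    have "continuous_on (sphere 0 1) \<psi>"
      unfolding \<psi>_def s_def by (intro continuous_intros cont_G_sphere)
    then show "continuous_on (sphere 0 1) \<phi>"
      unfolding \<phi>_def using \<psi>0 by (intro continuous_intros) auto
    show "\<phi> \<in> sphere 0 1 \<rightarrow> sphere 0 1"
      using \<psi>0 by (auto simp: \<phi>_def)
    fix u :: 'a assume u: "u \<in> sphere 0 1"
    have "G (- u) = - G u"
      using u by (intro odd_G) auto
    then have "\<psi> (- u) = - \<psi> u"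
      by (simp add: \<psi>_def s_def)
    then show "\<phi> (- u) = - \<phi> u"
      by (simp add: \<phi>_def)
    show "F (\<phi> u) \<le> F u"
      using F\<phi> [OF u] F\<psi> [OF u] s(1) [OF u]
      by (smt (verit) divide_nonneg_nonneg mult_nonneg_nonneg zero_le_power2)
    assume \<delta>: "norm (G u) \<ge> \<delta>"
    then have "d \<le> max 0 (norm (G u) - d)"
      unfolding d_def by linarith
    then have "t * d \<le> s u"
      unfolding s_def using t(1) by (intro mult_left_mono) auto
    moreover have "\<delta>\<^sup>2 \<le> (norm (G u))\<^sup>2"
      using \<delta> assms by (intro power_mono) auto
    ultimately have "t * d * \<delta>\<^sup>2 \<le> s u * (norm (G u))\<^sup>2"
      using s(1) [OF u] by (intro mult_mono) auto
    then show "F (\<phi> u) \<le> F u - t * d * \<delta>\<^sup>2 / 2"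
      using F\<phi> [OF u] F\<psi> [OF u] by linarith
  qed
qed

text \<open>On the compact zero set of \<open>h0\<close>, \<open>G\<close> and \<open>F - c\<close>
  have no common zero, so \<open>G\<close> is bounded away from 0 near the level \<open>c\<close>
  and one descent step gains a fixed amount.\<close>

lemma descent_across_level:
  assumes h0: "continuous_on (sphere 0 1) h0"
    and nocrit: "\<And>u. u \<in> sphere 0 1 \<Longrightarrow> h0 u = 0 \<Longrightarrow> F u = c \<Longrightarrow> G u \<noteq> 0"
  obtains \<epsilon> \<phi> where "\<epsilon> > 0" "continuous_on (sphere 0 1) \<phi>" "\<phi> \<in> sphere 0 1 \<rightarrow> sphere 0 1"
    "\<And>u. u \<in> sphere 0 1 \<Longrightarrow> \<phi> (- u) = - \<phi> u"
    "\<And>u. u \<in> sphere 0 1 \<Longrightarrow> h0 u = (0::real) \<Longrightarrow> F u \<le> c + \<epsilon> \<Longrightarrow> F (\<phi> u) \<le> c - \<epsilon>"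
proof -
  define Z where "Z = {u \<in> sphere 0 1. h0 u = 0}"
  define q where "q = (\<lambda>u. norm (G u) + \<bar>F u - c\<bar>)"
  have "compact Z"
  proof (rule closedin_compact)
    show "closedin (top_of_set (sphere 0 1)) Z"
      unfolding Z_def using continuous_closedin_preimage_constant [OF h0] by blast
  qed auto
  moreover have "continuous_on Z q"
    unfolding q_def Z_def
    by (intro continuous_intros continuous_on_subset [OF cont_F_sphere] continuous_on_subset [OF cont_G_sphere]) auto
  moreover have qpos: "q u > 0" if "u \<in> Z" for u
    using that nocrit [of u] by (cases "F u = c") (auto simp: q_def Z_def intro: add_pos_nonneg add_nonneg_pos)
  ultimately obtain \<mu> where \<mu>: "\<mu> > 0" "\<And>u. u \<in> Z \<Longrightarrow> q u \<ge> \<mu>"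
  proof (cases "Z = {}")
    case False
    then obtain w where "w \<in> Z" "\<forall>u\<in>Z. q w \<le> q u"
      using continuous_attains_inf \<open>compact Z\<close> \<open>continuous_on Z q\<close> by blast
    then show ?thesis
      using that [of "q w"] qpos by blast
  qed (use that [of 1] in auto)
  obtain \<phi> \<kappa> where \<kappa>: "\<kappa> > 0" and \<phi>: "continuous_on (sphere 0 1) \<phi>" "\<phi> \<in> sphere 0 1 \<rightarrow> sphere 0 1"
    "\<And>u. u \<in> sphere 0 1 \<Longrightarrow> \<phi> (- u) = - \<phi> u"
    and dec: "\<And>u. u \<in> sphere 0 1 \<Longrightarrow> F (\<phi> u) \<le> F u"
    "\<And>u. u \<in> sphere 0 1 \<Longrightarrow> norm (G u) \<ge> \<mu> / 2 \<Longrightarrow> F (\<phi> u) \<le> F u - \<kappa>"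
    using descent [of "\<mu> / 2"] \<mu>(1) by (metis half_gt_zero)
  \<comment> \<open>At points of \<open>Z\<close> with \<open>F\<close> within
    \<open>\<mu> / 2\<close> of \<open>c\<close> the gradient has norm at least
    \<open>\<mu> / 2\<close>, and the gain \<open>\<kappa>\<close> must cover the width
    \<open>2 * \<epsilon>\<close>.\<close>
  define \<epsilon> where "\<epsilon> = min (\<mu> / 2) (\<kappa> / 2)"
  show thesis
  proof (rule that [OF _ \<phi>])
    show "\<epsilon> > 0"
      using \<mu> \<kappa> by (simp add: \<epsilon>_def)
    fix u :: 'a assume u: "u \<in> sphere 0 1" "h0 u = 0" "F u \<le> c + \<epsilon>"
    show "F (\<phi> u) \<le> c - \<epsilon>"
    proof (cases "F u \<le> c - \<epsilon>")
      case True
      then show ?thesis using dec(1) [OF u(1)] by linarith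
    next
      case False
      then have "\<bar>F u - c\<bar> \<le> \<mu> / 2"
        using u(3) unfolding \<epsilon>_def by linarith
      then have "norm (G u) \<ge> \<mu> / 2"
        using \<mu>(2) [of u] u by (auto simp: q_def Z_def)
      then show ?thesis
        using dec(2) [OF u(1)] u(3) by (auto simp: \<epsilon>_def min_def split: if_splits)
    qed
  qed
qed

section \<open>Critical values and the genus of sublevel sets\<close>

definition critical_set :: "'a set" where
  "critical_set = {u \<in> sphere 0 1. G u = 0}"

text \<open>Values rather than points are counted, because one odd function deals with all critical
  points on the same level.\<close>

definition crit_below :: "real \<Rightarrow> nat" where
  "crit_below c = card {v \<in> F ` critical_set. v \<le> c}"

definition sublevel :: "real \<Rightarrow> 'a set" where
  "sublevel c = {u \<in> sphere 0 1. F u \<le> c}"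

text \<open>On the zero set of a suitable odd function the descent reaches the level
  \<open>c - \<epsilon>\<close>, and off it that function itself is nonzero. The conclusion counts
  only up to \<open>c\<close>, so it yields the bound at every level from \<open>c\<close> to
  \<open>c + \<epsilon>\<close>.\<close>

lemma sublevel_step:
  assumes fin: "finite critical_set"
  obtains \<epsilon> where "\<epsilon> > 0" "odd_nonvanishing (crit_below (c - \<epsilon>)) (sublevel (c - \<epsilon>)) \<Longrightarrow>
    odd_nonvanishing (crit_below c) (sublevel (c + \<epsilon>))"
proof -
  obtain v where v: "\<And>u. u \<in> critical_set \<Longrightarrow> v \<bullet> u \<noteq> 0"
    using ex_nonorthogonal [OF fin] by (auto simp: critical_set_def)
  \<comment> \<open>At a regular level \<open>h0\<close> is zero, so the whole sublevel set is
    pushed down and no function is spent; at a critical value the extra function is paid for by the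
    increase of \<open>crit_below\<close>.\<close>
  define h0 where "h0 = (\<lambda>u. if c \<in> F ` critical_set then v \<bullet> u else 0)"
  have h0: "continuous_on (sphere 0 1) h0" "h0 (- u) = - h0 u" for u
    by (cases "c \<in> F ` critical_set"; auto simp: h0_def intro!: continuous_intros)+
  have "G u \<noteq> 0" if "u \<in> sphere 0 1" "h0 u = 0" "F u = c" for u
    using that v [of u] by (auto simp: h0_def critical_set_def split: if_splits)
  then obtain \<epsilon> \<phi> where \<epsilon>: "\<epsilon> > 0"
    and \<phi>: "continuous_on (sphere 0 1) \<phi>" "\<phi> \<in> sphere 0 1 \<rightarrow> sphere 0 1"
    "\<And>u. u \<in> sphere 0 1 \<Longrightarrow> \<phi> (- u) = - \<phi> u"
    and dec: "\<And>u. u \<in> sphere 0 1 \<Longrightarrow> h0 u = 0 \<Longrightarrow> F u \<le> c + \<epsilon> \<Longrightarrow> F (\<phi> u) \<le> c - \<epsilon>"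
    using descent_across_level [OF h0(1)] by metis
  show thesis
  proof (rule that [OF \<epsilon>])
    assume *: "odd_nonvanishing (crit_below (c - \<epsilon>)) (sublevel (c - \<epsilon>))"
    have "\<phi> \<in> sublevel (c + \<epsilon>) \<inter> {u. h0 u = 0} \<rightarrow> sublevel (c - \<epsilon>)"
      using \<phi>(2) dec by (auto simp: sublevel_def Pi_iff)
    then have 1: "odd_nonvanishing (crit_below (c - \<epsilon>)) (sublevel (c + \<epsilon>) \<inter> {u. h0 u = 0})"
      using odd_nonvanishing_vimage [OF * \<phi>] by blast
    have finC: "finite {v \<in> F ` critical_set. v \<le> c}"
      using fin by auto
    show "odd_nonvanishing (crit_below c) (sublevel (c + \<epsilon>))"
    proof (cases "c \<in> F ` critical_set")
      case True
      have "{v \<in> F ` critical_set. v \<le> c - \<epsilon>} \<subset> {v \<in> F ` critical_set. v \<le> c}"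
      proof
        have "c \<in> {v \<in> F ` critical_set. v \<le> c}" "c \<notin> {v \<in> F ` critical_set. v \<le> c - \<epsilon>}"
          using True \<epsilon> by auto
        then show "{v \<in> F ` critical_set. v \<le> c - \<epsilon>} \<noteq> {v \<in> F ` critical_set. v \<le> c}"
          by blast
      qed (use \<epsilon> in auto)
      then have "Suc (crit_below (c - \<epsilon>)) \<le> crit_below c"
        unfolding crit_below_def by (intro Suc_leI psubset_card_mono finC)
      then show ?thesis
        using odd_nonvanishing_mono [OF odd_nonvanishing_Suc [OF 1 h0]] by blast
    next
      case False
      have "crit_below (c - \<epsilon>) \<le> crit_below c"
        unfolding crit_below_def using \<epsilon> by (intro card_mono finC) auto
      then show ?thesis
        using False by (intro odd_nonvanishing_mono [OF 1]) (auto simp: h0_def)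
    qed
  qed
qed

text \<open>A continuation argument in the level: very low sublevel sets are empty, and if the claim
  failed, the good levels would be bounded above by \<open>M\<close>, while
  \<open>sublevel_step\<close> at their supremum leads beyond it.\<close>

lemma odd_nonvanishing_sphere:
  assumes fin: "finite critical_set"
  shows "odd_nonvanishing (card (F ` critical_set)) (sphere (0::'a) 1)"
proof (rule ccontr)
  assume neg: "\<not> ?thesis"
  have "bounded (F ` sphere 0 1)"
    by (intro compact_imp_bounded compact_continuous_image cont_F_sphere compact_sphere)
  then obtain M where M: "\<And>u. u \<in> sphere 0 1 \<Longrightarrow> \<bar>F u\<bar> \<le> M"
    by (force simp: bounded_iff)
  have mono: "crit_below x \<le> crit_below y" if "x \<le> y" for x y
    unfolding crit_below_def using that fin by (intro card_mono) auto
  \<comment> \<open>Quantifying over all lower levels makes \<open>T\<close> an initial segment, so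
    every level below its supremum is good.\<close>
  define T where "T = {c. \<forall>c'\<le>c. odd_nonvanishing (crit_below c') (sublevel c')}"
  have "sublevel c = {}" if "c \<le> - M - 1" for c
    using that M by (force simp: sublevel_def)
  then have "- M - 1 \<in> T"
    by (auto simp: T_def odd_nonvanishing_empty)
  have "c \<le> M" if "c \<in> T" for c
  proof (rule ccontr)
    assume "\<not> c \<le> M"
    then have "sphere 0 1 \<subseteq> sublevel c"
      using M by (force simp: sublevel_def)
    moreover have "crit_below c \<le> card (F ` critical_set)"
      unfolding crit_below_def using fin by (intro card_mono) auto
    moreover have "odd_nonvanishing (crit_below c) (sublevel c)"
      using that unfolding T_def by blast
    ultimately show False
      using neg odd_nonvanishing_mono by blast
  qed
  then have bdd: "bdd_above T" by (rule bdd_aboveI)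
  define s where "s = Sup T"
  obtain \<epsilon> where \<epsilon>: "\<epsilon> > 0" and step: "odd_nonvanishing (crit_below (s - \<epsilon>)) (sublevel (s - \<epsilon>)) \<Longrightarrow>
    odd_nonvanishing (crit_below s) (sublevel (s + \<epsilon>))"
    using sublevel_step [OF fin] by metis
  have below: "odd_nonvanishing (crit_below c) (sublevel c)" if "c < s" for c
    using that less_cSup_iff [OF _ bdd] \<open>- M - 1 \<in> T\<close> unfolding s_def T_def by fastforce
  have "s + \<epsilon> \<in> T"
    unfolding T_def
  proof clarify
    fix c assume c: "c \<le> s + \<epsilon>"
    show "odd_nonvanishing (crit_below c) (sublevel c)"
    proof (cases "c < s")
      case False
      have "odd_nonvanishing (crit_below s) (sublevel (s + \<epsilon>))"
        using \<epsilon> by (intro step below) simp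
      moreover have "crit_below s \<le> crit_below c"
        using False by (intro mono) simp
      moreover have "sublevel c \<subseteq> sublevel (s + \<epsilon>)"
        using c by (auto simp: sublevel_def)
      ultimately show ?thesis
        by (rule odd_nonvanishing_mono)
    qed (rule below)
  qed
  then have "s + \<epsilon> \<le> s"
    unfolding s_def using bdd by (rule cSup_upper)
  with \<epsilon> show False by simp
qed

text \<open>One representative per value is taken together with its antipode. As \<open>F\<close> is
  even, a representative that is the antipode of another has the same value, so it would be its own
  antipode, which is impossible on the sphere.\<close>

lemma two_card_critical_values_le:
  assumes fin: "finite critical_set"
  shows "2 * card (F ` critical_set) \<le> card critical_set"
proof -
  define r where "r = inv_into critical_set F"
  define A where "A = r ` F ` critical_set"
  have r: "r c \<in> critical_set" "F (r c) = c" if "c \<in> F ` critical_set" for c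
    using that by (auto simp: r_def inv_into_into f_inv_into_f)
  have sym: "- u \<in> critical_set" "u \<noteq> 0" if "u \<in> critical_set" for u
  proof -
    show "u \<noteq> 0" using that by (auto simp: critical_set_def)
    then show "- u \<in> critical_set"
      using that odd_G by (auto simp: critical_set_def)
  qed
  have "inj_on r (F ` critical_set)"
    by (rule inj_on_inverseI [of _ F]) (use r in auto)
  then have card: "card A = card (F ` critical_set)"
    unfolding A_def by (rule card_image)
  have A: "A \<subseteq> critical_set" "finite A"
    using r fin by (auto simp: A_def)
  have "uminus ` A \<subseteq> critical_set"
    using A(1) sym by auto
  moreover have "A \<inter> uminus ` A = {}"
  proof (rule ccontr)
    assume "A \<inter> uminus ` A \<noteq> {}"
    then obtain c d where cd: "c \<in> F ` critical_set" "d \<in> F ` critical_set" "r c = - r d"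
      unfolding A_def by blast
    then have "c = d"
      using r(2) even by metis
    then show False
      using cd r(1) sym(2) by (metis neg_eq_iff_add_eq_0 scaleR_2 scaleR_eq_0_iff zero_neq_numeral)
  qed
  moreover have "card (uminus ` A) = card A"
    by (intro card_image) (simp add: inj_on_def)
  ultimately have "card (A \<union> uminus ` A) = card A + card A" "A \<union> uminus ` A \<subseteq> critical_set"
    using A by (simp_all add: card_Un_disjoint)
  moreover have "card (A \<union> uminus ` A) \<le> card critical_set"
    using fin calculation(2) by (rule card_mono)
  ultimately show ?thesis
    using card by simp
qed

end

section \<open>Radial reduction to the sphere\<close>

lemma class_C1_gradient:
  fixes f :: "'a::euclidean_space \<Rightarrow> real"
  assumes "class_C1 f"
  obtains D where "continuous_on UNIV D" "\<And>x. (f has_derivative (\<lambda>h. D x \<bullet> h)) (at x)"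
proof -
  obtain f' :: "'a \<Rightarrow> 'a \<Rightarrow>\<^sub>L real" where f': "\<And>x. (f has_derivative blinfun_apply (f' x)) (at x)"
    "continuous_on UNIV f'"
    using assms unfolding class_C1_def by blast
  define D where "D = (\<lambda>x. \<Sum>b\<in>Basis. blinfun_apply (f' x) b *\<^sub>R b)"
  show thesis
  proof
    show "continuous_on UNIV D"
      unfolding D_def by (intro continuous_intros f')
    have "D x \<bullet> h = blinfun_apply (f' x) h" for x h
    proof -
      have "blinfun_apply (f' x) h = blinfun_apply (f' x) (\<Sum>b\<in>Basis. (h \<bullet> b) *\<^sub>R b)"
        by (simp add: euclidean_representation)
      also have "\<dots> = D x \<bullet> h"
        by (simp only: D_def inner_sum_left blinfun.sum_right blinfun.scaleR_right)
          (simp add: inner_commute mult.commute)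
      finally show ?thesis by simp
    qed
    then have "(\<lambda>h. D x \<bullet> h) = blinfun_apply (f' x)" for x
      by (rule ext)
    then show "(f has_derivative (\<lambda>h. D x \<bullet> h)) (at x)" for x
      using f'(1) by simp
  qed
qed

text \<open>Since \<open>N x = 0\<close>, the increment of \<open>E\<close> enters only through
  \<open>N' (y - x) * (E y - E x)\<close>, which is of smaller order than \<open>y - x\<close>;
  continuity of \<open>E\<close> is enough. In the application \<open>E\<close> is a reciprocal
  slope at an intermediate point.\<close>

lemma has_derivative_mult_zero_isCont:
  fixes N E :: "'a::real_normed_vector \<Rightarrow> real"
  assumes N: "(N has_derivative N') (at x)" and "N x = 0" and E: "isCont E x"
  shows "((\<lambda>y. N y * E y) has_derivative (\<lambda>h. N' h * E x)) (at x)"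
proof -
  interpret N': bounded_linear N'
    using N by (rule has_derivative_bounded_linear)
  obtain K where K: "\<And>h. \<bar>N' h\<bar> \<le> norm h * K"
    using N'.bounded by auto
  have 1: "((\<lambda>y. norm (N y - N x - N' (y - x)) / norm (y - x)) \<longlongrightarrow> 0) (at x)"
    using N by (simp add: has_derivative_iff_norm)
  have E': "(E \<longlongrightarrow> E x) (at x)"
    using E by (simp add: isCont_def)
  have "((\<lambda>y. norm (N y - N x - N' (y - x)) / norm (y - x) * \<bar>E y\<bar> + K * \<bar>E y - E x\<bar>) \<longlongrightarrow>
      0 * \<bar>E x\<bar> + K * \<bar>E x - E x\<bar>) (at x)"
    by (intro tendsto_intros 1 E')
  then have lim: "((\<lambda>y. norm (N y - N x - N' (y - x)) / norm (y - x) * \<bar>E y\<bar> + K * \<bar>E y - E x\<bar>) \<longlongrightarrow> 0) (at x)"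
    by simp
  have "((\<lambda>y. norm (N y * E y - N x * E x - N' (y - x) * E x) / norm (y - x)) \<longlongrightarrow> 0) (at x)"
  proof (rule Lim_null_comparison [OF _ lim])
    show "\<forall>\<^sub>F y in at x. norm (norm (N y * E y - N x * E x - N' (y - x) * E x) / norm (y - x)) \<le>
        norm (N y - N x - N' (y - x)) / norm (y - x) * \<bar>E y\<bar> + K * \<bar>E y - E x\<bar>"
    proof (rule eventually_at_filter[THEN iffD2], rule always_eventually, intro allI impI)
      fix y assume "y \<noteq> x"
      then have pos: "norm (y - x) > 0" by simp
      have "N y * E y - N x * E x - N' (y - x) * E x =
          (N y - N x - N' (y - x)) * E y + N' (y - x) * (E y - E x)"
        using \<open>N x = 0\<close> by (simp add: algebra_simps)
      then have "norm (N y * E y - N x * E x - N' (y - x) * E x) \<le>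
          \<bar>N y - N x - N' (y - x)\<bar> * \<bar>E y\<bar> + \<bar>N' (y - x)\<bar> * \<bar>E y - E x\<bar>"
        by (metis abs_mult abs_triangle_ineq real_norm_def)
      also have "\<dots> \<le> \<bar>N y - N x - N' (y - x)\<bar> * \<bar>E y\<bar> + (norm (y - x) * K) * \<bar>E y - E x\<bar>"
        by (intro add_left_mono mult_right_mono K) auto
      finally show "norm (norm (N y * E y - N x * E x - N' (y - x) * E x) / norm (y - x)) \<le>
        norm (N y - N x - N' (y - x)) / norm (y - x) * \<bar>E y\<bar> + K * \<bar>E y - E x\<bar>"
        using divide_right_mono [of _ _ "norm (y - x)"] pos by (fastforce simp: add_divide_distrib)
    qed
  qed
  then show ?thesis
    by (simp add: has_derivative_iff_norm N'.bounded_linear_axioms bounded_linear_mult_const)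
qed

section \<open>The level set as a radial graph\<close>

locale radial_level =
  fixes g :: "'a::euclidean_space \<Rightarrow> real" and Dg :: "'a \<Rightarrow> 'a" and a :: real
  assumes deriv_g: "\<And>x. (g has_derivative (\<lambda>h. Dg x \<bullet> h)) (at x)"
    and cont_Dg: "continuous_on UNIV Dg"
    and g_zero: "g 0 = 0" and a_pos: "a > 0"
    and radial: "\<And>x. x \<noteq> 0 \<Longrightarrow> Dg x \<bullet> x > 0"
    and coercive: "filterlim g at_top at_infinity"
    and even_g: "\<And>x. g (- x) = g x"
begin

lemma isCont_g: "isCont g x"
  using deriv_g by (rule has_derivative_continuous)

lemma deriv_ray: "((\<lambda>r. g (r *\<^sub>R x)) has_real_derivative Dg (r *\<^sub>R x) \<bullet> x) (at r)"
proof -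
  have "((\<lambda>r. g (r *\<^sub>R x)) has_derivative (\<lambda>h. Dg (r *\<^sub>R x) \<bullet> (h *\<^sub>R x))) (at r)"
    by (rule has_derivative_compose [of "\<lambda>r. r *\<^sub>R x", OF _ deriv_g]) (auto intro!: derivative_eq_intros)
  then show ?thesis
    by (simp add: has_field_derivative_def mult_commute_abs)
qed

lemma deriv_ray_pos:
  assumes "x \<noteq> 0" "r > 0"
  shows "Dg (r *\<^sub>R x) \<bullet> x > 0"
  using radial [of "r *\<^sub>R x"] assms by (simp add: zero_less_mult_iff)

lemma ray_strict_mono:
  assumes "x \<noteq> 0" "0 < r" "r < s"
  shows "g (r *\<^sub>R x) < g (s *\<^sub>R x)"
  using assms deriv_ray deriv_ray_pos
  by (intro DERIV_pos_imp_increasing [of r s "\<lambda>r. g (r *\<^sub>R x)"]) (auto intro!: exI)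

lemma ex_level:
  assumes "x \<noteq> 0"
  shows "\<exists>r>0. g (r *\<^sub>R x) = a"
proof -
  obtain R where R: "R > 0" "\<And>y. norm y \<ge> R \<Longrightarrow> g y \<ge> a"
  proof -
    have "\<forall>\<^sub>F y in at_infinity. g y \<ge> a"
      using coercive by (simp add: filterlim_at_top)
    then obtain b where "\<And>y. norm y \<ge> b \<Longrightarrow> g y \<ge> a"
      by (auto simp: eventually_at_infinity)
    then show thesis
      using that [of "max b 1"] by auto
  qed
  have "g ((R / norm x) *\<^sub>R x) \<ge> a"
    using assms R by auto
  then obtain r where r: "0 \<le> r" "g (r *\<^sub>R x) = a"
    using IVT [of "\<lambda>r. g (r *\<^sub>R x)" 0 a "R / norm x"] R(1) assms g_zero a_pos DERIV_isCont [OF deriv_ray]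
    by auto
  then have "r \<noteq> 0"
    using g_zero a_pos by auto
  then show ?thesis
    using r by (intro exI [of _ r]) auto
qed

text \<open>A factor relative to \<open>x\<close>, hence homogeneous of degree -1. No such factor
  exists at the origin, but the unspecified value there does not affect
  \<open>radius x *\<^sub>R x\<close>.\<close>

definition radius :: "'a \<Rightarrow> real" where
  "radius x = (SOME r. r > 0 \<and> g (r *\<^sub>R x) = a)"

lemma radius:
  assumes "x \<noteq> 0"
  shows radius_pos: "radius x > 0" and g_radius: "g (radius x *\<^sub>R x) = a"
  using someI_ex [OF ex_level [OF assms]] by (auto simp: radius_def)

lemma radius_unique:
  assumes "x \<noteq> 0" "r > 0" "g (r *\<^sub>R x) = a"
  shows "radius x = r"
  using ray_strict_mono [OF assms(1), of r "radius x"] ray_strict_mono [OF assms(1), of "radius x" r] radius [OF assms(1)] assms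
  by linarith

lemma radius_scaleR:
  assumes "x \<noteq> 0" "r > 0"
  shows "radius (r *\<^sub>R x) *\<^sub>R r *\<^sub>R x = radius x *\<^sub>R x"
proof -
  have "radius (r *\<^sub>R x) = radius x / r"
    using assms radius [OF assms(1)] by (intro radius_unique) auto
  then show ?thesis
    using assms by simp
qed

lemma radius_minus:
  assumes "x \<noteq> 0"
  shows "radius (- x) = radius x"
  using assms radius [OF assms] even_g by (intro radius_unique) auto

text \<open>The values of \<open>g\<close> at the factors \<open>radius x - d\<close> and
  \<open>radius x + d\<close> lie strictly on either side of \<open>a\<close>. This persists on
  nearby rays, where monotonicity traps \<open>radius y\<close> between the two factors.\<close>

lemma isCont_radius:
  assumes x: "x \<noteq> 0"
  shows "isCont radius x"
  unfolding isCont_def tendsto_iff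
proof (intro allI impI)
  fix e :: real assume "e > 0"
  define d where "d = min e (radius x / 2)"
  have d: "d > 0" "d \<le> e" "d < radius x"
    using \<open>e > 0\<close> radius_pos [OF x] by (auto simp: d_def)
  have lim: "((\<lambda>y. g (r *\<^sub>R y)) \<longlongrightarrow> g (r *\<^sub>R x)) (at x)" for r
    by (intro isCont_tendsto_compose [OF isCont_g] tendsto_intros)
  have "g ((radius x - d) *\<^sub>R x) < a" "a < g ((radius x + d) *\<^sub>R x)"
    using ray_strict_mono [OF x, of "radius x - d" "radius x"] ray_strict_mono [OF x, of "radius x" "radius x + d"] g_radius [OF x] d radius_pos [OF x]
    by auto
  then have "\<forall>\<^sub>F y in at x. g ((radius x - d) *\<^sub>R y) < a" "\<forall>\<^sub>F y in at x. a < g ((radius x + d) *\<^sub>R y)"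
    using order_tendstoD [OF lim] by auto
  moreover have "\<forall>\<^sub>F y in at x. y \<noteq> 0"
    using tendsto_imp_eventually_ne [OF tendsto_ident_at x] .
  ultimately show "\<forall>\<^sub>F y in at x. dist (radius y) (radius x) < e"
  proof eventually_elim
    case (elim y)
    have "\<not> radius y \<le> radius x - d"
      using ray_strict_mono [of y "radius y" "radius x - d"] radius [OF elim(3)] elim by (cases "radius y = radius x - d") auto
    moreover have "\<not> radius y \<ge> radius x + d"
      using ray_strict_mono [of y "radius x + d" "radius y"] radius [OF elim(3)] elim d radius_pos [OF x]
      by (cases "radius y = radius x + d") auto
    ultimately show ?case
      using d by (auto simp: dist_real_def)
  qed
qed

text \<open>By the mean value theorem on the ray through \<open>y\<close>,
  \<open>radius y - radius x\<close> is \<open>a - g (radius x *\<^sub>R y)\<close> divided by the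
  slope at some \<open>\<xi> y\<close>. The numerator is differentiable and zero at
  \<open>x\<close>, and the slope is continuous there because \<open>\<xi> y\<close> tends to
  \<open>radius x\<close>.\<close>

lemma has_derivative_radius:
  assumes x: "x \<noteq> 0"
  defines "p \<equiv> radius x *\<^sub>R x"
  shows "(radius has_derivative (\<lambda>h. - (radius x * (Dg p \<bullet> h) / (Dg p \<bullet> x)))) (at x)"
proof -
  have "\<exists>\<xi>. \<bar>\<xi> - radius x\<bar> \<le> \<bar>radius y - radius x\<bar> \<and> \<xi> > 0 \<and>
      g (radius y *\<^sub>R y) - g (radius x *\<^sub>R y) = (radius y - radius x) * (Dg (\<xi> *\<^sub>R y) \<bullet> y)" if "y \<noteq> 0" for y
  proof -
    consider "radius x < radius y" | "radius y < radius x" | "radius y = radius x" by linarith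
    then show ?thesis
    proof cases
      case 1
      then show ?thesis
        using MVT2 [OF 1 deriv_ray [of y]] radius_pos [OF x] by (smt (verit))
    next
      case 2
      then obtain z where "radius y < z" "z < radius x"
        "g (radius x *\<^sub>R y) - g (radius y *\<^sub>R y) = (radius x - radius y) * (Dg (z *\<^sub>R y) \<bullet> y)"
        using MVT2 [OF 2 deriv_ray [of y]] by blast
      then show ?thesis
        using radius_pos [OF that] by (intro exI [of _ z]) (auto simp: algebra_simps)
    next
      case 3
      then show ?thesis
        using radius_pos [OF x] by (intro exI [of _ "radius x"]) auto
    qed
  qed
  then obtain \<xi> where \<xi>: "\<And>y. y \<noteq> 0 \<Longrightarrow> \<bar>\<xi> y - radius x\<bar> \<le> \<bar>radius y - radius x\<bar>" "\<And>y. y \<noteq> 0 \<Longrightarrow> \<xi> y > 0"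
    "\<And>y. y \<noteq> 0 \<Longrightarrow> g (radius y *\<^sub>R y) - g (radius x *\<^sub>R y) = (radius y - radius x) * (Dg (\<xi> y *\<^sub>R y) \<bullet> y)"
    by metis
  have \<xi>x: "\<xi> x = radius x"
    using \<xi>(1) [OF x] by simp
  have ne: "\<forall>\<^sub>F y in at x. y \<noteq> 0"
    using tendsto_imp_eventually_ne [OF tendsto_ident_at x] .
  have "((\<lambda>y. \<bar>radius y - radius x\<bar>) \<longlongrightarrow> 0) (at x)"
    using isCont_radius [OF x] by (auto simp: isCont_def intro!: tendsto_eq_intros)
  then have "((\<lambda>y. \<xi> y - radius x) \<longlongrightarrow> 0) (at x)"
    by (rule Lim_null_comparison [rotated]) (use ne \<xi>(1) in \<open>auto elim: eventually_mono\<close>)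
  then have "isCont \<xi> x"
    using \<xi>x by (simp add: isCont_def LIM_zero_iff)
  then have "isCont (\<lambda>y. \<xi> y *\<^sub>R y) x"
    by (intro continuous_intros)
  moreover have "isCont Dg (\<xi> x *\<^sub>R x)"
    using cont_Dg by (simp add: continuous_on_eq_continuous_at)
  ultimately have "isCont (\<lambda>y. Dg (\<xi> y *\<^sub>R y)) x"
    by (rule isCont_o2)
  then have E: "isCont (\<lambda>y. 1 / (Dg (\<xi> y *\<^sub>R y) \<bullet> y)) x"
    using deriv_ray_pos [OF x radius_pos [OF x]] by (intro continuous_intros) (auto simp: \<xi>x)
  have "((\<lambda>y. g (radius x *\<^sub>R y)) has_derivative (\<lambda>h. Dg p \<bullet> (radius x *\<^sub>R h))) (at x)"
    unfolding p_def by (rule has_derivative_compose [of "\<lambda>y. radius x *\<^sub>R y", OF _ deriv_g])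
      (auto intro!: derivative_eq_intros)
  then have "((\<lambda>y. a - g (radius x *\<^sub>R y)) has_derivative (\<lambda>h. - (Dg p \<bullet> (radius x *\<^sub>R h)))) (at x)"
    by (auto intro!: derivative_eq_intros)
  from has_derivative_mult_zero_isCont [OF this _ E]
  have "((\<lambda>y. (a - g (radius x *\<^sub>R y)) * (1 / (Dg (\<xi> y *\<^sub>R y) \<bullet> y))) has_derivative
      (\<lambda>h. - (Dg p \<bullet> (radius x *\<^sub>R h)) * (1 / (Dg p \<bullet> x)))) (at x)"
    by (simp add: g_radius [OF x] \<xi>x p_def)
  from has_derivative_add [OF has_derivative_const [of "radius x"] this]
  have "((\<lambda>y. radius x + (a - g (radius x *\<^sub>R y)) * (1 / (Dg (\<xi> y *\<^sub>R y) \<bullet> y))) has_derivative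
      (\<lambda>h. - (Dg p \<bullet> (radius x *\<^sub>R h)) * (1 / (Dg p \<bullet> x)))) (at x)"
    by simp
  then have "(radius has_derivative (\<lambda>h. - (Dg p \<bullet> (radius x *\<^sub>R h)) * (1 / (Dg p \<bullet> x)))) (at x)"
  proof (rule has_derivative_transform_within_open [of _ _ _ _ "- {0}"])
    fix y :: 'a assume "y \<in> - {0}"
    then have y: "y \<noteq> 0" by simp
    then have "Dg (\<xi> y *\<^sub>R y) \<bullet> y > 0"
      using deriv_ray_pos \<xi>(2) by blast
    then show "radius x + (a - g (radius x *\<^sub>R y)) * (1 / (Dg (\<xi> y *\<^sub>R y) \<bullet> y)) = radius y"
      using \<xi>(3) [OF y] g_radius [OF y] by (simp add: field_simps)
  qed (use x in auto)
  then show ?thesis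
    by simp
qed

text \<open>By the chain rule, differentiating \<open>radius\<close> contributes the multiple of
  \<open>Dg ?p\<close>. Its coefficient is the Lagrange multiplier, so a zero of the gradient away
  from the origin gives the Lagrange equation at \<open>?p\<close>.\<close>

lemma even_homogeneous_radial:
  assumes deriv_f: "\<And>x. (f has_derivative (\<lambda>h. Df x \<bullet> h)) (at x)"
    and cont_Df: "continuous_on UNIV Df" and even_f: "\<And>x. f (- x) = f x"
  shows "even_homogeneous (\<lambda>x. f (radius x *\<^sub>R x))
    (\<lambda>x. radius x *\<^sub>R (Df (radius x *\<^sub>R x) - ((Df (radius x *\<^sub>R x) \<bullet> x) / (Dg (radius x *\<^sub>R x) \<bullet> x)) *\<^sub>R Dg (radius x *\<^sub>R x)))"
proof
  fix x :: 'a assume x: "x \<noteq> 0"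
  let ?p = "radius x *\<^sub>R x"
  have "((\<lambda>x. radius x *\<^sub>R x) has_derivative (\<lambda>h. radius x *\<^sub>R h + (- (radius x * (Dg ?p \<bullet> h) / (Dg ?p \<bullet> x))) *\<^sub>R x)) (at x)"
    by (rule has_derivative_scaleR [OF has_derivative_radius [OF x] has_derivative_ident])
  then have "((\<lambda>x. f (radius x *\<^sub>R x)) has_derivative
      (\<lambda>h. Df ?p \<bullet> (radius x *\<^sub>R h + (- (radius x * (Dg ?p \<bullet> h) / (Dg ?p \<bullet> x))) *\<^sub>R x))) (at x)"
    by (rule has_derivative_compose [OF _ deriv_f])
  moreover have "Df ?p \<bullet> (radius x *\<^sub>R h + (- (radius x * (Dg ?p \<bullet> h) / (Dg ?p \<bullet> x))) *\<^sub>R x) =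
      radius x *\<^sub>R (Df ?p - ((Df ?p \<bullet> x) / (Dg ?p \<bullet> x)) *\<^sub>R Dg ?p) \<bullet> h" for h
    by (simp add: inner_add_right inner_diff_right inner_diff_left right_diff_distrib)
  ultimately show "((\<lambda>x. f (radius x *\<^sub>R x)) has_derivative
      (\<lambda>h. radius x *\<^sub>R (Df ?p - ((Df ?p \<bullet> x) / (Dg ?p \<bullet> x)) *\<^sub>R Dg ?p) \<bullet> h)) (at x)"
    by simp
next
  have cradius: "continuous_on (- {0}) radius"
    using isCont_radius by (intro continuous_at_imp_continuous_on) auto
  have "continuous_on (- {0}) (\<lambda>x. radius x *\<^sub>R x)"
    by (intro continuous_intros cradius)
  then have cp: "continuous_on (- {0}) (\<lambda>x. Dg (radius x *\<^sub>R x))" "continuous_on (- {0}) (\<lambda>x. Df (radius x *\<^sub>R x))"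
    using continuous_on_compose2 [OF cont_Dg] continuous_on_compose2 [OF cont_Df] by blast+
  show "continuous_on (- {0}) (\<lambda>x. radius x *\<^sub>R (Df (radius x *\<^sub>R x) -
      ((Df (radius x *\<^sub>R x) \<bullet> x) / (Dg (radius x *\<^sub>R x) \<bullet> x)) *\<^sub>R Dg (radius x *\<^sub>R x)))"
    by (intro continuous_intros cradius cp) (use deriv_ray_pos radius_pos in force)
next
  show "f (radius (r *\<^sub>R x) *\<^sub>R r *\<^sub>R x) = f (radius x *\<^sub>R x)" if "r > 0" for r x
    using radius_scaleR [OF _ that, of x] by (cases "x = 0") auto
  show "f (radius (- x) *\<^sub>R - x) = f (radius x *\<^sub>R x)" for x
    using radius_minus [of x] even_f by (cases "x = 0") auto
qed

end

section \<open>Transfer to the constrained problem\<close>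

theorem theorem23:
  fixes f g :: "real ^ 'n \<Rightarrow> real" and a :: real
  assumes "\<And>x. f (- x) = f x" and "\<And>x. g (- x) = g x"
    and "class_C1 f" and "class_C1 g"
    and "a > 0"
    and "{x. g x = 0} = {0}"
    and "\<And>x. x \<noteq> 0 \<Longrightarrow> frechet_derivative g (at x) x > 0"
    and "filterlim g at_top at_infinity"
  shows "\<exists>S. S \<subseteq> {x. critical_point f g a x} \<and> finite S \<and> card S = 2 * CARD('n)"
proof -
  obtain Df where Df: "continuous_on UNIV Df" "\<And>x. (f has_derivative (\<lambda>h. Df x \<bullet> h)) (at x)"
    using class_C1_gradient [OF assms(3)] by blast
  obtain Dg where Dg: "continuous_on UNIV Dg" "\<And>x. (g has_derivative (\<lambda>h. Dg x \<bullet> h)) (at x)"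
    using class_C1_gradient [OF assms(4)] by blast
  have fd: "frechet_derivative f (at x) = (\<lambda>h. Df x \<bullet> h)" "frechet_derivative g (at x) = (\<lambda>h. Dg x \<bullet> h)" for x
    using frechet_derivative_at [OF Df(2)] frechet_derivative_at [OF Dg(2)] by metis+
  interpret L: radial_level g Dg a
    using assms Dg by unfold_locales (auto simp: fd)
  define F where "F = (\<lambda>x. f (L.radius x *\<^sub>R x))"
  define G where "G = (\<lambda>x. L.radius x *\<^sub>R (Df (L.radius x *\<^sub>R x) -
    ((Df (L.radius x *\<^sub>R x) \<bullet> x) / (Dg (L.radius x *\<^sub>R x) \<bullet> x)) *\<^sub>R Dg (L.radius x *\<^sub>R x)))"
  interpret H: even_homogeneous F G
    unfolding F_def G_def by (rule L.even_homogeneous_radial [OF Df(2,1) assms(1)])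
  let ?C = "{x. critical_point f g a x}"
  let ?r = "\<lambda>u. L.radius u *\<^sub>R u"
  have sub: "?r ` H.critical_set \<subseteq> ?C"
  proof clarify
    fix u assume u: "u \<in> H.critical_set"
    then have "u \<noteq> 0" "G u = 0"
      by (auto simp: H.critical_set_def)
    then have "Df (?r u) = ((Df (?r u) \<bullet> u) / (Dg (?r u) \<bullet> u)) *\<^sub>R Dg (?r u)"
      using L.radius_pos [of u] by (simp add: G_def)
    then obtain l where "Df (?r u) = l *\<^sub>R Dg (?r u)" ..
    then have "(\<lambda>h. Df (?r u) \<bullet> h) = (\<lambda>h. l * (Dg (?r u) \<bullet> h))"
      by simp
    then show "critical_point f g a (?r u)"
      unfolding critical_point_def fd using L.g_radius [OF \<open>u \<noteq> 0\<close>] by blast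
  qed
  \<comment> \<open>On unit vectors the length of \<open>?r u\<close> is \<open>L.radius u\<close>,
    so equal images have equal factors.\<close>
  have inj: "inj_on ?r H.critical_set"
  proof (rule inj_onI)
    fix u w assume uw: "u \<in> H.critical_set" "w \<in> H.critical_set" "?r u = ?r w"
    then have n: "norm u = 1" "norm w = 1" "u \<noteq> 0" "w \<noteq> 0"
      by (auto simp: H.critical_set_def)
    have "norm (?r u) = norm (?r w)"
      using uw by simp
    then have "L.radius u = L.radius w"
      using n L.radius_pos [of u] L.radius_pos [of w] by simp
    then show "u = w"
      using uw(3) L.radius_pos [OF n(3)] by simp
  qed
  \<comment> \<open>An infinite set contains finite subsets of every size, so only the finite case
    needs counting: Borsuk--Ulam forces at least \<open>CARD('n)\<close> critical values, and
    antipodal pairs double this.\<close>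
  have "2 * CARD('n) \<le> card ?C" if "finite ?C"
  proof -
    have "finite (?r ` H.critical_set)"
      using sub that by (rule finite_subset)
    then have fin: "finite H.critical_set"
      using inj by (rule finite_imageD)
    obtain h :: "nat \<Rightarrow> real ^ 'n \<Rightarrow> real" where
      "\<forall>i<card (F ` H.critical_set). continuous_on (sphere 0 1) (h i) \<and> (\<forall>u\<in>sphere 0 1. h i (- u) = - h i u)"
      "\<forall>u\<in>sphere 0 1. \<exists>i<card (F ` H.critical_set). h i u \<noteq> 0"
      using H.odd_nonvanishing_sphere [OF fin] unfolding odd_nonvanishing_def by blast
    then have "DIM(real ^ 'n) \<le> card (F ` H.critical_set)"
      by (intro Borsuk_Ulam [of _ h]) blast+
    then have "2 * CARD('n) \<le> card H.critical_set"
      using H.two_card_critical_values_le [OF fin] by simp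
    also have "\<dots> = card (?r ` H.critical_set)"
      using inj by (simp add: card_image)
    also have "\<dots> \<le> card ?C"
      using that sub by (rule card_mono)
    finally show ?thesis .
  qed
  then show ?thesis
    by (metis infinite_arbitrarily_large obtain_subset_with_card_n)
qed

end
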